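(* Let $P$ be a finite $(3+1)$-free poset, $\alpha=(\alpha_1\ge\alpha_2\ge\cdots\ge\alpha_\ell\ge0)$ a partition, and $\mathbf Z=(Z_1,\dots,Z_\ell)$ lower order ideals of $P$ with $Z_1\subseteq Z_2\subseteq\cdots\subseteq Z_\ell$. Then $$J^P_\alpha(\mathbf Z)\equiv\sum_{T\in\mathrm{SSYT}^{\mathbf Z}_P(\alpha')}\mathbf{u}_{\mathrm{diagword}(T)}\pmod{I^P_{\mathrm{plac}}}.$$
   Context: $a<_Pb$: strict order; $a\sim_Pb$: incomparable or equal. $\mathcal{U}_P=\mathbb{Z}\langle u_a:a\in P\rangle$, $\mathbf u_w=u_{w_1}\cdots u_{w_m}$. For $S\subseteq P$, $e^P_k(\mathbf u_S)=\sum u_{a_1}\cdots u_{a_k}$ over $a_1>_P\cdots>_Pa_k$ in $S$, $e^P_0(\mathbf u_S)=1$, $e^P_k(\mathbf u_S)=0$ for $k<0$ or $k>|S|$. $J^P_\alpha(\mathbf Z)=\sum_{\pi\in S_\ell}\mathrm{sgn}(\pi)\,e^P_{\alpha_1+\pi(1)-1}(\mathbf u_{Z_1})e^P_{\alpha_2+\pi(2)-2}(\mathbf u_{Z_2})\cdots e^P_{\alpha_\ell+\pi(\ell)-\ell}(\mathbf u_{Z_\ell})$. $I^P_{\mathrm{plac}}$ is generated by $u_bu_au_c-u_bu_cu_a$ ($a<_Pb$, $c\not<_Pb$, $a<_Pc$), $u_cu_au_b-u_au_cu_b$ ($b\not<_Pa$, $b<_Pc$, $a<_Pc$), $u_cu_au_b-u_bu_cu_a$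 ($a\sim_Pb$, $b\sim_Pc$, $a<_Pc$). $\alpha'$ denotes the diagram $\{(i,j): j\in[\ell], i\in[\alpha_j]\}$ (column $j$ has height $\alpha_j$; English notation). $\mathrm{SSYT}^{\mathbf Z}_P(\alpha')$ is the set of fillings $T$ of $\alpha'$ by elements of $P$ with $T(1,j)<_PT(2,j)<_P\cdots<_PT(\alpha_j,j)$, $T(r,c+1)\not<_PT(r,c)$ whenever both boxes lie in $\alpha'$, and all entries of column $j$ in $Z_j$. $\mathrm{diagword}(T)$ is obtained by reading each diagonal $\{(r,c): c-r=\text{const}\}$ in the southeast direction (increasing $r$) and concatenating the diagonals starting from the southwesternmost one (smallest $c-r$). *)

theory Defs
  imports "HOL-Combinatorics.Permutations"
begin

section \<open>Free associative ring Z<u_a : a in P>, elements as coefficient functions on words\<close>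

type_synonym 'a ncpoly = "'a list \<Rightarrow> int"

definition nc_monom :: "'a list \<Rightarrow> 'a ncpoly" where
  "nc_monom w = (\<lambda>v. if v = w then 1 else 0)"

definition nc_zero :: "'a ncpoly" where "nc_zero = (\<lambda>v. 0)"
definition nc_one :: "'a ncpoly" where "nc_one = nc_monom []"
definition nc_add :: "'a ncpoly \<Rightarrow> 'a ncpoly \<Rightarrow> 'a ncpoly" where
  "nc_add f g = (\<lambda>w. f w + g w)"
definition nc_neg :: "'a ncpoly \<Rightarrow> 'a ncpoly" where
  "nc_neg f = (\<lambda>w. - f w)"
definition nc_diff :: "'a ncpoly \<Rightarrow> 'a ncpoly \<Rightarrow> 'a ncpoly" where
  "nc_diff f g = (\<lambda>w. f w - g w)"
definition nc_smult :: "int \<Rightarrow> 'a ncpoly \<Rightarrow> 'a ncpoly" where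
  "nc_smult c f = (\<lambda>w. c * f w)"
definition nc_mult :: "'a ncpoly \<Rightarrow> 'a ncpoly \<Rightarrow> 'a ncpoly" where
  "nc_mult f g = (\<lambda>w. \<Sum>i\<le>length w. f (take i w) * g (drop i w))"
definition nc_sum :: "('b \<Rightarrow> 'a ncpoly) \<Rightarrow> 'b set \<Rightarrow> 'a ncpoly" where
  "nc_sum F A = (\<lambda>w. \<Sum>x\<in>A. F x w)"
definition nc_prod_list :: "('b \<Rightarrow> 'a ncpoly) \<Rightarrow> 'b list \<Rightarrow> 'a ncpoly" where
  "nc_prod_list F xs = foldr (\<lambda>x acc. nc_mult (F x) acc) xs nc_one"

text \<open>The finite poset P is the finite ordered type 'a; a <_P b is a < b.\<close>

definition three_plus_one_free :: "'a::order itself \<Rightarrow> bool" where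
  "three_plus_one_free _ \<longleftrightarrow>
     \<not> (\<exists>a b c d :: 'a. a < b \<and> b < c \<and>
           \<not> (d < a \<or> a < d \<or> d = a) \<and> \<not> (d < b \<or> b < d \<or> d = b) \<and>
           \<not> (d < c \<or> c < d \<or> d = c))"

definition lower_order_ideal :: "'a::order set \<Rightarrow> bool" where
  "lower_order_ideal Z \<longleftrightarrow> (\<forall>x y. y \<in> Z \<longrightarrow> x < y \<longrightarrow> x \<in> Z)"

definition psim :: "'a::order \<Rightarrow> 'a \<Rightarrow> bool" where
  "psim a b \<longleftrightarrow> \<not> a < b \<and> \<not> b < a"

definition dec_chains :: "nat \<Rightarrow> 'a::order set \<Rightarrow> 'a list set" where
  "dec_chains k S = {w. length w = k \<and> set w \<subseteq> S \<and> sorted_wrt (\<lambda>x y. x > y) w}"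

definition eP :: "int \<Rightarrow> 'a::order set \<Rightarrow> 'a ncpoly" where
  "eP k S = (if k < 0 then nc_zero else nc_sum nc_monom (dec_chains (nat k) S))"

text \<open>Indices 0-based: alpha_{i+1} + pi(i+1) - (i+1) = alpha!i + pi i - i for pi permuting {0..<l}.\<close>
definition JP :: "nat list \<Rightarrow> 'a::order set list \<Rightarrow> 'a ncpoly" where
  "JP \<alpha> Z = nc_sum
     (\<lambda>\<pi>. nc_smult (sign \<pi>)
        (nc_prod_list (\<lambda>i. eP (int (\<alpha> ! i) + int (\<pi> i) - int i) (Z ! i)) [0..<length \<alpha>]))
     {\<pi>. \<pi> permutes {..<length \<alpha>}}"

inductive plac_gen :: "'a::order ncpoly \<Rightarrow> bool" where
  g1: "\<lbrakk>a < b; \<not> c < b; a < c\<rbrakk> \<Longrightarrow> plac_gen (nc_diff (nc_monom [b,a,c]) (nc_monom [b,c,a]))"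
| g2: "\<lbrakk>\<not> b < a; b < c; a < c\<rbrakk> \<Longrightarrow> plac_gen (nc_diff (nc_monom [c,a,b]) (nc_monom [a,c,b]))"
| g3: "\<lbrakk>psim a b; psim b c; a < c\<rbrakk> \<Longrightarrow> plac_gen (nc_diff (nc_monom [c,a,b]) (nc_monom [b,c,a]))"

text \<open>Two-sided ideal of Z<u> generated by plac_gen: the Z-span of u_v r u_w.\<close>
inductive_set I_plac :: "'a::order ncpoly set" where
  zero: "nc_zero \<in> I_plac"
| gen: "plac_gen r \<Longrightarrow> r \<in> I_plac"
| add: "x \<in> I_plac \<Longrightarrow> y \<in> I_plac \<Longrightarrow> nc_add x y \<in> I_plac"
| neg: "x \<in> I_plac \<Longrightarrow> nc_neg x \<in> I_plac"
| lmult: "x \<in> I_plac \<Longrightarrow> nc_mult (nc_monom [a]) x \<in> I_plac"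
| rmult: "x \<in> I_plac \<Longrightarrow> nc_mult x (nc_monom [a]) \<in> I_plac"

definition plac_cong :: "'a::order ncpoly \<Rightarrow> 'a ncpoly \<Rightarrow> bool" where
  "plac_cong f g \<longleftrightarrow> nc_diff f g \<in> I_plac"

text \<open>A filling of alpha' is a list of columns; column j (0-based) has length alpha!j,
  listed top to bottom, so T(r,c) (0-based) is T ! c ! r.\<close>
definition SSYT_Z :: "nat list \<Rightarrow> 'a::order set list \<Rightarrow> 'a list list set" where
  "SSYT_Z \<alpha> Z = {T. length T = length \<alpha>
      \<and> (\<forall>j<length \<alpha>. length (T ! j) = \<alpha> ! j)
      \<and> (\<forall>j<length \<alpha>. \<forall>r. Suc r < \<alpha> ! j \<longrightarrow> T ! j ! r < T ! j ! Suc r)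
      \<and> (\<forall>j. Suc j < length \<alpha> \<longrightarrow> (\<forall>r. r < \<alpha> ! j \<and> r < \<alpha> ! Suc j \<longrightarrow>
              \<not> (T ! Suc j ! r < T ! j ! r)))
      \<and> (\<forall>j<length \<alpha>. set (T ! j) \<subseteq> Z ! j)}"

text \<open>Boxes (r,c) of alpha', ordered by diagonal d = c - r increasing, and within a
  diagonal by r increasing.\<close>
definition diag_boxes :: "nat list \<Rightarrow> (nat \<times> nat) list" where
  "diag_boxes \<alpha> = concat (map (\<lambda>d.
       map (\<lambda>r. (r, nat (int r + d)))
         (filter (\<lambda>r. int r + d \<ge> 0 \<and> nat (int r + d) < length \<alpha> \<and> r < \<alpha> ! nat (int r + d))
            [0..<sum_list \<alpha>]))
     [- int (sum_list \<alpha>) .. int (length \<alpha>)])"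

definition diagword :: "nat list \<Rightarrow> 'a list list \<Rightarrow> 'a list" where
  "diagword \<alpha> T = map (\<lambda>(r, c). T ! c ! r) (diag_boxes \<alpha>)"

end

theory Submission
  imports Defs
begin

text \<open>Pass to the quotient ring of finitely supported elements by the congruence; there only the three
  relations matter. A first relation lets a letter slide through a chain, a second gives
  \<open>e\<^sub>k(L) u\<^sub>m = u\<^sub>m e\<^sub>k(L) + K e\<^sub>k\<^sub>-\<^sub>1(L)\<close> with \<open>L = {z. z < m}\<close> and
  \<open>K = \<Sum>\<^sub>z [u\<^sub>z, u\<^sub>m]\<close>. Sorting the chains by their top elements, an induction on principal ideals
  then shows that \<open>e\<^sub>a(S)\<close> and \<open>e\<^sub>b(S)\<close> commute for every lower order ideal \<open>S\<close>.

  The determinant is expanded box by box, row by row from the bottom, each row from left to right: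
  the entry \<open>x\<close> placed to the right of \<open>a\<close> is the maximum of a chain in an ideal that contains
  \<open>{z. z < a}\<close>; the chains lying inside \<open>{z. z < a}\<close> contribute a determinant in which two
  adjacent rows have commuting entries over the same set, hence \<open>0\<close>. What remains are the
  column reading words of the tableaux, and these agree with the diagonal words by sliding.\<close>

section \<open>Chains and elementary functions in a ring with the plactic relations\<close>

lemma dec_chains_Suc:
  "dec_chains (Suc n) S = (\<Union>x\<in>S. (#) x ` dec_chains n {z\<in>S. z < x})"
proof (intro set_eqI iffI)
  fix w assume "w \<in> dec_chains (Suc n) S"
  then show "w \<in> (\<Union>x\<in>S. (#) x ` dec_chains n {z\<in>S. z < x})"
    by (cases w) (auto simp: dec_chains_def)
next
  fix w assume "w \<in> (\<Union>x\<in>S. (#) x ` dec_chains n {z\<in>S. z < x})"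
  then show "w \<in> dec_chains (Suc n) S" by (auto simp: dec_chains_def)
qed

lemma finite_dec_chains: "finite (dec_chains n (S :: 'a::{finite,order} set))"
proof -
  have "finite {w :: 'a list. set w \<subseteq> UNIV \<and> length w = n}"
    by (rule finite_lists_length_eq) simp
  then show ?thesis by (rule rev_finite_subset) (auto simp: dec_chains_def)
qed

text \<open>If \<open>a < x\<close> failed, any relation between \<open>x\<close> and a member of
  the chain would force \<open>a < x\<close> or \<open>x < c\<close>, so the chain and
  \<open>x\<close> would form a forbidden 3+1. Every later use of freeness goes through this
  lemma.\<close>

lemma three_chain_comparable:
  fixes x :: "'a::order"
  assumes "three_plus_one_free TYPE('a)" "a < b" "b < c" "\<not> x < c"
  shows "a < x"
proof (rule ccontr)
  assume "\<not> a < x"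
  then have "\<not> (x < a \<or> a < x \<or> x = a)" "\<not> (x < b \<or> b < x \<or> x = b)" "\<not> (x < c \<or> c < x \<or> x = c)"
    using assms(2-4) by (auto dest: order.strict_trans)
  then show False
    using assms(1-3) unfolding three_plus_one_free_def by blast
qed

text \<open>Lets a cubic relation rewrite the front of a product that \<open>mult.assoc\<close> has
  bracketed to the right.\<close>

lemma mult3_extend:
  fixes x y z :: "'r::semigroup_mult"
  assumes "x * y * z = x' * y' * z'"
  shows "x * (y * (z * t)) = x' * (y' * (z' * t))"
  using arg_cong[OF assms, of "\<lambda>p. p * t"] by (simp add: mult.assoc)

lemma lower_ideal_below: "lower_order_ideal {..<x::'a::order}"
  by (auto simp: lower_order_ideal_def)

lemma lower_ideal_Int_below:
  "lower_order_ideal S \<Longrightarrow> x \<in> S \<Longrightarrow> {z\<in>S. z < x} = {..<x}"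
  by (auto simp: lower_order_ideal_def)

text \<open>The combinatorics uses only the three relations, so it is carried out in an arbitrary
  ring with elements satisfying them; the plactic quotient becomes an interpretation.\<close>

locale plac_algebra =
  fixes u :: "'a::{finite,order} \<Rightarrow> 'r::ring_1"
  assumes free31: "three_plus_one_free TYPE('a)"
    and rel1: "a < b \<Longrightarrow> \<not> c < b \<Longrightarrow> a < c \<Longrightarrow> u b * u a * u c = u b * u c * u a"
    and rel2: "\<not> b < a \<Longrightarrow> b < c \<Longrightarrow> a < c \<Longrightarrow> u c * u a * u b = u a * u c * u b"
    and rel3: "psim a b \<Longrightarrow> psim b c \<Longrightarrow> a < c \<Longrightarrow> u c * u a * u b = u b * u c * u a"
begin

definition uw :: "'a list \<Rightarrow> 'r" where "uw w = prod_list (map u w)"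

lemma uw_simps [simp]: "uw [] = 1" "uw (x # w) = u x * uw w" "uw (v @ w) = uw v * uw w"
  by (simp_all add: uw_def)

definition e :: "int \<Rightarrow> 'a set \<Rightarrow> 'r" where
  "e k S = (if k < 0 then 0 else \<Sum>w\<in>dec_chains (nat k) S. uw w)"

lemma e_neg [simp]: "k < 0 \<Longrightarrow> e k S = 0" by (simp add: e_def)

lemma e_0 [simp]: "e 0 S = 1"
proof -
  have "dec_chains 0 S = {[]}" by (auto simp: dec_chains_def)
  then show ?thesis by (simp add: e_def)
qed

text \<open>Decreasing words are sorted by their first letter, the top of the chain. Since
  \<open>e\<close> is \<open>0\<close> in negative degree, the formula is uniform: for
  \<open>k = 0\<close> only the empty chain remains.\<close>

lemma e_rec_general:
  "e k S = (if k = 0 then 1 else 0) + (\<Sum>x\<in>S. u x * e (k - 1) {z\<in>S. z < x})"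
proof -
  consider "k < 0" | "k = 0" | n where "k = int (Suc n)"
    by (metis linorder_neqE_linordered_idom pos_int_cases Suc_pred')
  then show ?thesis
  proof cases
    case 3
    have "e k S = (\<Sum>w\<in>(\<Union>x\<in>S. (#) x ` dec_chains n {z\<in>S. z < x}). uw w)"
      unfolding 3 e_def nat_int dec_chains_Suc by simp
    also have "\<dots> = (\<Sum>x\<in>S. \<Sum>w\<in>(#) x ` dec_chains n {z\<in>S. z < x}. uw w)"
      by (rule sum.UNION_disjoint) (auto simp: finite_dec_chains)
    also have "\<dots> = (\<Sum>x\<in>S. u x * e (k - 1) {z\<in>S. z < x})"
      by (rule sum.cong) (auto simp: sum.reindex 3 e_def sum_distrib_left)
    finally show ?thesis using 3 by simp
  qed simp_all
qed

text \<open>In a lower order ideal the letters below the top \<open>x\<close> form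
  \<open>{..<x}\<close>, whatever the ideal; hence \<open>e_split\<close> can compare two ideals by
  their tops alone.\<close>

lemma e_rec:
  assumes "lower_order_ideal S"
  shows "e k S = (if k = 0 then 1 else 0) + (\<Sum>x\<in>S. u x * e (k - 1) {..<x})"
  unfolding e_rec_general[of k S]
  using assms by (intro arg_cong2[of _ _ _ _ "(+)"] sum.cong refl) (simp add: lower_ideal_Int_below)

lemma e_split:
  assumes "lower_order_ideal S" "lower_order_ideal T" "T \<subseteq> S"
  shows "e k S = e k T + (\<Sum>x\<in>S - T. u x * e (k - 1) {..<x})"
  using assms by (simp add: e_rec[of S] e_rec[of T] sum.subset_diff[of T S] ac_simps)

text \<open>A letter slides leftwards through a strictly decreasing chain as long as some
  letter in front of the chain is not above it; each step is \<open>rel1\<close>.\<close>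

lemma e_slide:
  assumes "lower_order_ideal T" "\<And>z. z \<in> T \<Longrightarrow> z < b \<and> z < n" "\<not> n < b"
  shows "u b * e k T * u n = u b * u n * e k T"
proof -
  have "u b * e (int k) T * u n = u b * u n * e (int k) T" for k
    using assms
  proof (induction k arbitrary: b T)
    case 0
    then show ?case by simp
  next
    case (Suc k)
    have step: "u b * (u x * e (int k) {..<x}) * u n = u b * u n * (u x * e (int k) {..<x})"
      if "x \<in> T" for x
    proof -
      have x: "x < b" "x < n" using Suc.prems(2) that by auto
      have "u x * e (int k) {..<x} * u n = u x * u n * e (int k) {..<x}"
        using x by (intro Suc.IH lower_ideal_below) auto
      moreover have "u b * u x * u n = u b * u n * u x"
        using x Suc.prems(3) by (intro rel1)
      ultimately show ?thesis
        by (simp add: mult.assoc mult3_extend[of "u b" "u x" "u n" "u b" "u n" "u x"])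
    qed
    show ?case
      using step by (simp add: e_rec[OF Suc.prems(1), of "1 + int k"] sum_distrib_left sum_distrib_right)
  qed
  from this[of "nat k"] show ?thesis by (cases "k < 0") auto
qed

text \<open>The head \<open>x\<close> of the chain takes over the role of \<open>b\<close> for the
  rest of the chain, since \<open>x < n\<close> excludes \<open>n < x\<close>.\<close>

lemma uw_slide:
  assumes "sorted_wrt (>) w" "\<And>z. z \<in> set w \<Longrightarrow> z < b \<and> z < n" "\<not> n < b"
  shows "u b * uw w * u n = u b * u n * uw w"
  using assms
proof (induction w arbitrary: b)
  case (Cons x w)
  have "x < b" "x < n" using Cons.prems(2) by auto
  then have "\<not> n < x" by (blast dest: order.asym)
  then have "u x * uw w * u n = u x * u n * uw w"
    using Cons.prems(1,2) by (intro Cons.IH) simp_all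
  moreover have "u b * u x * u n = u b * u n * u x"
    using Cons.prems by (intro rel1) auto
  ultimately show ?case
    by (simp add: mult.assoc mult3_extend[of "u b" "u x" "u n" "u b" "u n" "u x"])
qed simp

end

section \<open>Commutation of the elementary functions on a lower order ideal\<close>

text \<open>Expand the commutator over pairs of indices: diagonal pairs vanish, the others cancel
  against their transposes.\<close>

lemma sum_commute_of_pairs:
  fixes f g :: "'b \<Rightarrow> 'r::ring"
  assumes "finite M" "\<And>z. z \<in> M \<Longrightarrow> f z * g z = g z * f z"
    and "\<And>z w. z \<in> M \<Longrightarrow> w \<in> M \<Longrightarrow> z \<noteq> w \<Longrightarrow>
      (f z * g w - g z * f w) + (f w * g z - g w * f z) = 0"
  shows "sum f M * sum g M = sum g M * sum f M"
  using assms
proof (induction M)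
  case (insert x M)
  have "(\<Sum>w\<in>M. (f x * g w - g x * f w) + (f w * g x - g w * f x)) = 0"
    using insert.prems(2) insert.hyps(2) by (intro sum.neutral) auto
  then have "f x * sum g M - g x * sum f M + (sum f M * g x - sum g M * f x) = 0"
    by (simp add: sum.distrib sum_subtractf sum_distrib_left sum_distrib_right)
  moreover have "sum f M * sum g M = sum g M * sum f M"
    using insert.prems by (intro insert.IH) auto
  ultimately show ?case
    using insert.hyps insert.prems(1)[of x] by (simp add: algebra_simps)
qed simp

context plac_algebra
begin

text \<open>The chains with top \<open>z\<close>: a part of \<open>e k S\<close> for every lower
  order ideal \<open>S\<close> containing \<open>z\<close>.\<close>

definition e_top :: "int \<Rightarrow> 'a \<Rightarrow> 'r" where "e_top k z = u z * e (k - 1) {..<z}"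

lemma e_eq_sum_top: "lower_order_ideal S \<Longrightarrow> e k S = (if k = 0 then 1 else 0) + sum (e_top k) S"
  unfolding e_top_def by (rule e_rec)

lemma e_split_top:
  "lower_order_ideal S \<Longrightarrow> lower_order_ideal T \<Longrightarrow> T \<subseteq> S \<Longrightarrow> e k S = e k T + sum (e_top k) (S - T)"
  unfolding e_top_def by (rule e_split)

definition ecomm :: "'a set \<Rightarrow> bool" where
  "ecomm S \<longleftrightarrow> (\<forall>a b. e a S * e b S = e b S * e a S)"

text \<open>The part of the commutator of \<open>e a S\<close> and \<open>e b S\<close> in which the
  first factor has top \<open>z\<close> and the second has top \<open>w\<close>.\<close>

definition bracket :: "int \<Rightarrow> int \<Rightarrow> 'a \<Rightarrow> 'a \<Rightarrow> 'r" where
  "bracket a b z w = e_top a z * e_top b w - e_top b z * e_top a w"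

text \<open>Pairing \<open>(m, n)\<close> with \<open>(n, m)\<close> keeps the argument valid in rings with 2-torsion.\<close>

definition cancelling :: "'a \<Rightarrow> 'a \<Rightarrow> bool" where
  "cancelling m n \<longleftrightarrow> (\<forall>a b. bracket a b m n + bracket a b n m = 0)"

text \<open>By \<open>rel2\<close>, the commutator of \<open>u z\<close> and \<open>u m\<close>
  kills the chains of \<open>e (k - 1) {..<m}\<close> whose top is not below \<open>z\<close>. On
  the chains below \<open>z\<close>, \<open>e_slide\<close> moves \<open>u m\<close> across, which
  yields the commutator of \<open>e_top k z\<close> with \<open>u m\<close>. It matters later that
  the factor in front does not depend on \<open>k\<close>.\<close>

lemma e_below_mult:
  "e k {..<m} * u m = u m * e k {..<m} + (\<Sum>z<m. u z * u m - u m * u z) * e (k - 1) {..<m}"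
proof -
  have "(u z * u m - u m * u z) * e (k - 1) {..<m} = e_top k z * u m - u m * e_top k z" if "z < m" for z
  proof -
    have "(u z * u m - u m * u z) * (u x * t) = 0" if "x \<in> {..<m} - {..<z}" for x t
    proof -
      have "u m * u z * u x = u z * u m * u x" using that \<open>z < m\<close> by (intro rel2) auto
      then have "(u z * u m - u m * u z) * u x * t = 0" by (simp add: left_diff_distrib)
      then show ?thesis by (simp add: mult.assoc)
    qed
    then have "(u z * u m - u m * u z) * e (k - 1) {..<m} = (u z * u m - u m * u z) * e (k - 1) {..<z}"
      using that by (subst e_split[of _ "{..<z}"]) (auto simp: lower_ideal_below distrib_left sum_distrib_left)
    moreover have "u z * e (k - 1) {..<z} * u m = u z * u m * e (k - 1) {..<z}"
      using that by (intro e_slide lower_ideal_below) auto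
    ultimately show ?thesis by (simp add: e_top_def left_diff_distrib mult.assoc)
  qed
  then have "(\<Sum>z<m. u z * u m - u m * u z) * e (k - 1) {..<m}
      = sum (e_top k) {..<m} * u m - u m * sum (e_top k) {..<m}"
    by (simp add: sum_distrib_right sum_distrib_left flip: sum_subtractf)
  then show ?thesis
    by (cases "k = 0") (simp_all add: e_eq_sum_top[OF lower_ideal_below, of k] algebra_simps)
qed

text \<open>Taking \<open>b = n = m\<close> in \<open>e_slide\<close> brings both copies of
  \<open>u m\<close> to the front and leaves two elementary functions of the same ideal.\<close>

lemma e_top_commute:
  assumes "ecomm {..<m}"
  shows "e_top a m * e_top b m = e_top b m * e_top a m"
proof -
  have "u m * e k {..<m} * u m = u m * u m * e k {..<m}" for k
    by (intro e_slide lower_ideal_below) auto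
  then have "e_top a m * e_top b m = u m * u m * (e (a - 1) {..<m} * e (b - 1) {..<m})" for a b
    by (simp add: e_top_def mult.assoc[symmetric])
  then show ?thesis using assms by (simp add: ecomm_def)
qed

text \<open>Pairs with comparable tops are cancelled in total, not one by one. Moving
  \<open>u m\<close> to the left past \<open>E k\<close> costs \<open>K * E (k - 1)\<close> with the
  same \<open>K\<close> in every degree, so what remains are commutators of elementary functions of
  \<open>{..<m}\<close>.\<close>

lemma sum_bracket_below:
  assumes "ecomm {..<m}"
  shows "(\<Sum>z<m. bracket a b m z + bracket a b z m) = 0"
proof -
  define K where "K = (\<Sum>z<m. u z * u m - u m * u z)"
  define E where "E k = e k {..<m}" for k
  \<comment> \<open>The contribution of the empty chain, which has no top; being central, it drops
    out below.\<close>
  define d :: "int \<Rightarrow> 'r" where "d k = (if k = 0 then 1 else 0)" for k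
  have sc: "sum (e_top k) {..<m} = E k - d k" for k
    using e_eq_sum_top[OF lower_ideal_below, of k m] by (simp add: E_def d_def)
  have EM: "E k * u m = u m * E k + K * E (k - 1)" for k
    unfolding E_def K_def by (rule e_below_mult)
  have EE: "E j * E k = E k * E j" for j k
    using assms by (simp add: E_def ecomm_def)
  have d: "d k * x = x * d k" for k and x :: 'r by (simp add: d_def)
  have cm: "e_top k m = u m * E (k - 1)" for k by (simp add: e_top_def E_def)
  have "(\<Sum>z<m. bracket a b m z + bracket a b z m)
     = e_top a m * (E b - d b) - e_top b m * (E a - d a) + ((E a - d a) * e_top b m - (E b - d b) * e_top a m)"
    by (simp add: bracket_def sum.distrib sum_subtractf flip: sum_distrib_left sum_distrib_right sc)
  also have "\<dots> = e_top a m * E b - e_top b m * E a + (E a * e_top b m - E b * e_top a m)"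
    by (simp add: algebra_simps d)
  also have "\<dots> = u m * (E (a-1) * E b) - u m * (E (b-1) * E a) + ((E a * u m) * E (b-1) - (E b * u m) * E (a-1))"
    by (simp add: cm mult.assoc)
  also have "\<dots> = u m * (E (a-1) * E b - E b * E (a-1)) - u m * (E (b-1) * E a - E a * E (b-1))
      + K * (E (a-1) * E (b-1) - E (b-1) * E (a-1))"
    unfolding EM by (simp add: algebra_simps)
  also have "\<dots> = 0"
    using EE[of "a-1" b] EE[of "b-1" a] EE[of "a-1" "b-1"] by simp
  finally show ?thesis .
qed

text \<open>Remove a maximal element \<open>m\<close>. Its brackets with the elements below it
  vanish in total by \<open>sum_bracket_below\<close>, those with the other elements vanish in pairs
  by hypothesis, and the smaller ideals \<open>S - {m}\<close> and \<open>{..<m}\<close> are covered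
  by induction.\<close>

lemma ecomm_of_cancelling:
  assumes "lower_order_ideal S"
    and "\<And>m n. m \<in> S \<Longrightarrow> n \<in> S \<Longrightarrow> psim m n \<Longrightarrow> m \<noteq> n \<Longrightarrow> cancelling m n"
  shows "ecomm S"
  using finite[of S] assms
proof (induction S rule: finite_psubset_induct)
  case (psubset S)
  show ?case
  proof (cases "S = {}")
    case True
    moreover have "e k {} = (if k = 0 then 1 else 0)" for k
      using e_rec_general[of k "{}"] by simp
    ultimately show ?thesis by (simp add: ecomm_def)
  next
    case False
    then obtain m where m: "m \<in> S" "\<And>z. z \<in> S \<Longrightarrow> m \<le> z \<Longrightarrow> m = z"
      using finite_has_maximal[of S] by auto
    define S' where "S' = S - {m}"
    have S': "lower_order_ideal S'" "S' \<subset> S" "S - S' = {m}" "S' \<subseteq> S"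
      using psubset.prems(1) m by (auto simp: lower_order_ideal_def S'_def dest: order.strict_implies_order)
    have L: "{..<m} \<subseteq> S'"
      using psubset.prems(1) m by (auto simp: lower_order_ideal_def S'_def)
    have "ecomm S'"
      by (rule psubset.IH) (use S' psubset.prems(2) in blast)+
    have "ecomm {..<m}"
      by (rule psubset.IH) (use L S' psubset.prems(2) lower_ideal_below in blast)+
    show ?thesis
      unfolding ecomm_def
    proof (intro allI)
      fix a b
      have split: "e k S = e k S' + e_top k m" for k
        using e_split_top[OF psubset.prems(1) S'(1) S'(4), of k] S'(3) by simp
      have "bracket a b m z + bracket a b z m = 0" if "z \<in> S' - {..<m}" for z
      proof -
        have "psim m z" "m \<noteq> z"
          using that m(2)[of z] order.strict_implies_order[of m z] by (auto simp: S'_def psim_def)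
        then have "cancelling m z" using psubset.prems(2) m(1) that by (auto simp: S'_def)
        then show ?thesis by (simp add: cancelling_def)
      qed
      then have "(\<Sum>z\<in>S'. bracket a b m z + bracket a b z m) = 0"
        using sum.subset_diff[OF L, of "\<lambda>z. bracket a b m z + bracket a b z m"]
          sum_bracket_below[OF \<open>ecomm {..<m}\<close>, of a b] by simp
      then have "e_top a m * sum (e_top b) S' - e_top b m * sum (e_top a) S'
         + (sum (e_top a) S' * e_top b m - sum (e_top b) S' * e_top a m) = 0"
        by (simp add: bracket_def sum.distrib sum_subtractf sum_distrib_left sum_distrib_right)
      \<comment> \<open>The tops miss only the constant term, which is central, so full elementary
        functions may replace them.\<close>
      then have "e_top a m * e b S' - e_top b m * e a S' + (e a S' * e_top b m - e b S' * e_top a m) = 0"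
        by (cases "a = 0"; cases "b = 0") (simp_all add: e_eq_sum_top[OF S'(1)] algebra_simps)
      moreover have "e a S' * e b S' = e b S' * e a S'"
        using \<open>ecomm S'\<close> by (simp add: ecomm_def)
      moreover have "e_top a m * e_top b m = e_top b m * e_top a m"
        using \<open>ecomm {..<m}\<close> by (rule e_top_commute)
      ultimately show "e a S * e b S = e b S * e a S"
        by (simp add: split algebra_simps)
    qed
  qed
qed

text \<open>Induction on the size of \<open>{..<m} \<union> {..<n}\<close>; by
  \<open>ecomm_of_cancelling\<close> the induction hypothesis yields commutation on every ideal
  inside this union. Moving \<open>u m\<close> and \<open>u n\<close> to the front sorts the
  brackets by the prefixes \<open>u m * u n\<close> and \<open>u n * u m\<close>, whose coefficients
  vanish separately.\<close>

lemma cancelling_incomparable: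
  assumes "psim m n" "m \<noteq> n"
  shows "cancelling m n"
  using assms
proof (induction "card ({..<m} \<union> {..<n})" arbitrary: m n rule: less_induct)
  case less
  define L K I where "L = {..<m}" and "K = {..<n}" and "I = L \<inter> K"
  define DL DK where "DL k = sum (e_top k) (L - I)" and "DK k = sum (e_top k) (K - I)" for k
  have IH: "cancelling z w" if "psim z w" "z \<noteq> w" "z \<in> L \<union> K" "w \<in> L \<union> K" for z w
  proof (rule less.hyps)
    \<comment> \<open>Strict, since \<open>z\<close> lies in the right-hand side but is neither
      below itself nor below \<open>w\<close>.\<close>
    have "{..<z} \<union> {..<w} \<subset> L \<union> K"
      using that by (fastforce simp: L_def K_def psim_def)
    then show "card ({..<z} \<union> {..<w}) < card ({..<m} \<union> {..<n})"
      unfolding L_def K_def by (intro psubset_card_mono) auto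
  qed (use that in auto)
  have comm: "ecomm S" if "lower_order_ideal S" "S \<subseteq> L \<union> K" for S
    using that IH by (intro ecomm_of_cancelling) auto
  have comm_below: "ecomm {..<z}" if "z \<in> L \<union> K" for z
    using that by (intro comm lower_ideal_below) (auto simp: L_def K_def)
  have low: "lower_order_ideal L" "lower_order_ideal K" "lower_order_ideal I"
    by (auto simp: lower_order_ideal_def L_def K_def I_def)
  have mn: "\<not> m < n" "\<not> n < m" using less.prems by (auto simp: psim_def)
  \<comment> \<open>Freeness puts everything below \<open>z\<close> into \<open>I\<close>: if
    \<open>y < z < m\<close> and \<open>n\<close> is not below \<open>m\<close>, then
    \<open>y < n\<close>.\<close>
  have zL: "z < m" "\<not> z < n" "psim z n" "{..<z} \<subseteq> I" if "z \<in> L - I" for z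
    using that mn three_chain_comparable[OF free31, of _ z m n]
    by (auto simp: L_def K_def I_def psim_def)
  have zK: "z < n" "\<not> z < m" "psim z m" "{..<z} \<subseteq> I" if "z \<in> K - I" for z
    using that mn three_chain_comparable[OF free31, of _ z n m]
    by (auto simp: L_def K_def I_def psim_def)
  have EL: "e k L = e k I + DL k" and EK: "e k K = e k I + DK k" for k
    unfolding DL_def DK_def by (intro e_split_top low; simp add: I_def)+
  have slideI: "u m * e k I * u n = u m * u n * e k I" "u n * e k I * u m = u n * u m * e k I" for k
    using mn by (intro e_slide low; simp add: I_def L_def K_def)+
  \<comment> \<open>Here \<open>z < m\<close> and \<open>n\<close> is incomparable to both, so
    \<open>rel3\<close> carries \<open>u n\<close> to the very front and produces the opposite
    prefix.\<close>
  have slideL: "u m * DL k * u n = u n * u m * DL k" for k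
    unfolding DL_def sum_distrib_left sum_distrib_right
  proof (intro sum.cong refl)
    fix z assume z: "z \<in> L - I"
    have "u m * u z * u n = u n * u m * u z"
      using zL[OF z] less.prems(1) by (intro rel3) (auto simp: psim_def)
    moreover have "u z * e (k - 1) {..<z} * u n = u z * u n * e (k - 1) {..<z}"
      using zL[OF z] by (intro e_slide lower_ideal_below) (auto simp: psim_def I_def K_def)
    ultimately show "u m * e_top k z * u n = u n * u m * e_top k z"
      by (simp add: e_top_def mult.assoc mult3_extend[of "u m" "u z" "u n" "u n" "u m" "u z"])
  qed
  have slideK: "u n * DK k * u m = u m * u n * DK k" for k
    unfolding DK_def sum_distrib_left sum_distrib_right
  proof (intro sum.cong refl)
    fix z assume z: "z \<in> K - I"
    have "u n * u z * u m = u m * u n * u z"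
      using zK[OF z] less.prems(1) by (intro rel3) (auto simp: psim_def)
    moreover have "u z * e (k - 1) {..<z} * u m = u z * u m * e (k - 1) {..<z}"
      using zK[OF z] by (intro e_slide lower_ideal_below) (auto simp: psim_def I_def L_def)
    ultimately show "u n * e_top k z * u m = u m * u n * e_top k z"
      by (simp add: e_top_def mult.assoc mult3_extend[of "u n" "u z" "u m" "u m" "u n" "u z"])
  qed
  \<comment> \<open>Distinct elements of \<open>L - I\<close> are incomparable because everything
    below them lies in \<open>I\<close>, and likewise for \<open>K - I\<close>; so their brackets
    cancel by the induction hypothesis.\<close>
  have DD: "DL a * DL b = DL b * DL a" "DK a * DK b = DK b * DK a" for a b
  proof -
    have "sum (e_top a) M * sum (e_top b) M = sum (e_top b) M * sum (e_top a) M"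
      if "M = L - I \<or> M = K - I" for M
    proof (rule sum_commute_of_pairs)
      fix z assume "z \<in> M"
      then show "e_top a z * e_top b z = e_top b z * e_top a z"
        using that by (intro e_top_commute comm_below) auto
    next
      fix z w assume zw: "z \<in> M" "w \<in> M" "z \<noteq> w"
      then have "psim z w"
        using that zL(4)[of z] zL(4)[of w] zK(4)[of z] zK(4)[of w] by (auto simp: psim_def)
      then have "cancelling z w" using zw that by (intro IH) auto
      then show "e_top a z * e_top b w - e_top b z * e_top a w + (e_top a w * e_top b z - e_top b w * e_top a z) = 0"
        by (simp add: cancelling_def bracket_def)
    qed simp
    then show "DL a * DL b = DL b * DL a" "DK a * DK b = DK b * DK a"
      by (auto simp: DL_def DK_def)
  qed
  \<comment> \<open>(3+1)-freeness forces \<open>{..<z} = {..<w}\<close> here, so these brackets vanish one by one.\<close>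
  have cross: "e_top a z * e_top b w = e_top b z * e_top a w" "e_top a w * e_top b z = e_top b w * e_top a z"
    if "z \<in> L - I" "w \<in> K - I" for a b z w
  proof -
    have zw: "\<not> z < w" "\<not> w < z"
      using zL(4)[OF that(1)] zK(4)[OF that(2)] that by auto
    have eq: "{..<z} = {..<w}"
      using three_chain_comparable[OF free31, of _ z m w] zL[OF that(1)]
        three_chain_comparable[OF free31, of _ w n z] zK[OF that(2)] by auto
    have J: "ecomm {..<w}" using that by (intro comm_below) auto
    have "u z * e k {..<w} * u w = u z * u w * e k {..<w}" for k
      using zw eq by (intro e_slide lower_ideal_below) auto
    then have "e_top a z * e_top b w = u z * u w * (e (a - 1) {..<w} * e (b - 1) {..<w})" for a b
      by (simp add: e_top_def eq mult.assoc[symmetric])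
    then show "e_top a z * e_top b w = e_top b z * e_top a w" using J by (simp add: ecomm_def)
    have "u w * e k {..<w} * u z = u w * u z * e k {..<w}" for k
      using zw eq by (intro e_slide lower_ideal_below) auto
    then have "e_top a w * e_top b z = u w * u z * (e (a - 1) {..<w} * e (b - 1) {..<w})" for a b
      by (simp add: e_top_def eq mult.assoc[symmetric])
    then show "e_top a w * e_top b z = e_top b w * e_top a z" using J by (simp add: ecomm_def)
  qed
  have DX: "DL a * DK b = DL b * DK a" "DK a * DL b = DK b * DL a" for a b
    unfolding DL_def DK_def sum_product by (intro sum.cong refl cross; assumption)+
  have comEL: "e a L * e b L = e b L * e a L" and comEK: "e a K * e b K = e b K * e a K" for a b
    using comm[OF low(1)] comm[OF low(2)] by (auto simp: ecomm_def)
  show ?case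
    unfolding cancelling_def
  proof (intro allI)
    fix a' b' :: int
    define a b where "a = a' - 1" and "b = b' - 1"
    have cm: "e_top k m = u m * (e (k - 1) I + DL (k - 1))" and cn: "e_top k n = u n * (e (k - 1) I + DK (k - 1))" for k
      unfolding EL[symmetric] EK[symmetric] by (simp_all add: e_top_def L_def K_def)
    have mn: "e_top i m * e_top j n = (u m * u n * e (i - 1) I + u n * u m * DL (i - 1)) * e (j - 1) K" for i j
      unfolding cm cn EK[symmetric] using slideI(1)[of "i - 1"] slideL[of "i - 1"]
      by (simp add: distrib_left distrib_right flip: mult.assoc)
    have nm: "e_top i n * e_top j m = (u n * u m * e (i - 1) I + u m * u n * DK (i - 1)) * e (j - 1) L" for i j
      unfolding cm cn EL[symmetric] using slideI(2)[of "i - 1"] slideK[of "i - 1"]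
      by (simp add: distrib_left distrib_right flip: mult.assoc)
    have "bracket a' b' m n + bracket a' b' n m =
      u m * u n * (e a I * e b K - e b I * e a K + DK a * e b L - DK b * e a L) +
      u n * u m * (DL a * e b K - DL b * e a K + e a I * e b L - e b I * e a L)"
      unfolding bracket_def mn nm a_def b_def by (simp add: algebra_simps)
    \<comment> \<open>Substituting \<open>EL\<close> and \<open>EK\<close> exposes two commutators
      and one mixed difference, all known to be zero.\<close>
    also have "e a I * e b K - e b I * e a K + DK a * e b L - DK b * e a L
      = (e a K * e b K - e b K * e a K) - (DK a * DK b - DK b * DK a) + (DK a * DL b - DK b * DL a)"
      unfolding EL EK by (simp add: algebra_simps)
    also have "\<dots> = 0" using comEK DD(2) DX(2) by simp
    also have "DL a * e b K - DL b * e a K + e a I * e b L - e b I * e a L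
      = (e a L * e b L - e b L * e a L) - (DL a * DL b - DL b * DL a) + (DL a * DK b - DL b * DK a)"
      unfolding EL EK by (simp add: algebra_simps)
    also have "\<dots> = 0" using comEL DD(1) DX(1) by simp
    finally show "bracket a' b' m n + bracket a' b' n m = 0" by simp
  qed
qed

lemma e_commute:
  assumes "lower_order_ideal S"
  shows "e a S * e b S = e b S * e a S"
  using ecomm_of_cancelling[OF assms] cancelling_incomparable by (simp add: ecomm_def)

end

section \<open>Determinants with noncommuting entries\<close>

text \<open>Leibniz expansion with the factors in row order. It is linear in each row, but over a
  noncommutative ring equal rows do not force it to vanish; \<open>ndet_adjacent_symmetric\<close>
  is the substitute.\<close>

definition ndet :: "nat \<Rightarrow> (nat \<Rightarrow> nat \<Rightarrow> 'r::ring_1) \<Rightarrow> 'r" where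
  "ndet l g = (\<Sum>\<pi> | \<pi> permutes {..<l}. of_int (sign \<pi>) * prod_list (map (\<lambda>j. g j (\<pi> j)) [0..<l]))"

lemma ndet_cong:
  assumes "\<And>j p. j < l \<Longrightarrow> p < l \<Longrightarrow> g j p = h j p"
  shows "ndet l g = ndet l h"
proof -
  have "\<pi> j < l" if "\<pi> permutes {..<l}" "j < l" for \<pi> j
    using permutes_in_image[OF that(1), of j] that(2) by simp
  then show ?thesis
    unfolding ndet_def
    by (intro sum.cong refl arg_cong2[of _ _ _ _ "(*)"] arg_cong[of _ _ prod_list] map_cong)
       (simp add: assms)
qed

lemma prod_list_upt_split:
  assumes "i < l"
  shows "prod_list (map f [0..<l]) = prod_list (map f [0..<i]) * (f i * prod_list (map f [Suc i..<l]))"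
proof -
  have "[0..<l] = [0..<i] @ i # [Suc i..<l]"
    using assms upt_add_eq_append[of 0 i "l - i"] upt_conv_Cons[of i l] by simp
  then show ?thesis by simp
qed

lemma ndet_row_add_sum:
  assumes i: "i < l"
    and same: "\<And>j p. j < l \<Longrightarrow> j \<noteq> i \<Longrightarrow> g0 j p = g j p" "\<And>x j p. x \<in> X \<Longrightarrow> j < l \<Longrightarrow> j \<noteq> i \<Longrightarrow> h x j p = g j p"
    and row: "\<And>p. p < l \<Longrightarrow> g i p = g0 i p + (\<Sum>x\<in>X. h x i p)"
  shows "ndet l g = ndet l g0 + (\<Sum>x\<in>X. ndet l (h x))"
proof -
  have "of_int (sign \<pi>) * prod_list (map (\<lambda>j. g j (\<pi> j)) [0..<l])
     = of_int (sign \<pi>) * prod_list (map (\<lambda>j. g0 j (\<pi> j)) [0..<l])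
       + (\<Sum>x\<in>X. of_int (sign \<pi>) * prod_list (map (\<lambda>j. h x j (\<pi> j)) [0..<l]))"
    if "\<pi> permutes {..<l}" for \<pi>
  proof -
    have "\<pi> i < l" using permutes_in_image[OF that, of i] i by simp
    define u v where "u = prod_list (map (\<lambda>j. g j (\<pi> j)) [0..<i])"
      and "v = prod_list (map (\<lambda>j. g j (\<pi> j)) [Suc i..<l])"
    have *: "prod_list (map (\<lambda>j. f j (\<pi> j)) [0..<l]) = u * (f i (\<pi> i) * v)"
      if "\<And>j p. j < l \<Longrightarrow> j \<noteq> i \<Longrightarrow> f j p = g j p" for f
      unfolding prod_list_upt_split[OF i] u_def v_def using that i
      by (intro arg_cong2[of _ _ _ _ "(*)"] arg_cong[of _ _ prod_list] map_cong refl) auto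
    have "(\<Sum>x\<in>X. of_int (sign \<pi>) * prod_list (map (\<lambda>j. h x j (\<pi> j)) [0..<l]))
      = (\<Sum>x\<in>X. of_int (sign \<pi>) * (u * (h x i (\<pi> i) * v)))"
      by (intro sum.cong refl arg_cong2[of _ _ _ _ "(*)"] *) (simp add: same)
    then show ?thesis
      using *[of g] *[of g0] same(1) row[OF \<open>\<pi> i < l\<close>]
      by (simp add: algebra_simps flip: sum_distrib_left sum_distrib_right)
  qed
  then show ?thesis
    unfolding ndet_def by (subst sum.swap) (simp flip: sum.distrib)
qed

text \<open>Writing the zero row as the sum of two copies of itself gives
  \<open>ndet l g = ndet l g + ndet l g\<close>.\<close>

lemma ndet_zero_row:
  assumes "i < l" "\<And>p. p < l \<Longrightarrow> g i p = 0"
  shows "ndet l g = 0"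
  using ndet_row_add_sum[OF assms(1), of g g "{()}" "\<lambda>_. g"] assms(2) by simp

text \<open>Exchanging the values at \<open>i\<close> and \<open>Suc i\<close> flips the sign and,
  the two factors being neighbours, keeps the product. Pairing permutations by the order of these
  values avoids dividing by 2.\<close>

lemma ndet_adjacent_symmetric:
  assumes i: "Suc i < l"
    and sym: "\<And>p q. p < l \<Longrightarrow> q < l \<Longrightarrow> g i p * g (Suc i) q = g i q * g (Suc i) p"
  shows "ndet l g = 0"
proof -
  define t where "t \<pi> = of_int (sign \<pi>) * prod_list (map (\<lambda>j. g j (\<pi> j)) [0..<l])" for \<pi>
  define \<tau> where "\<tau> = transpose i (Suc i)"
  define P A B where "P = {\<pi>. \<pi> permutes {..<l}}"
    and "A = {\<pi> \<in> P. \<pi> i < \<pi> (Suc i)}" and "B = {\<pi> \<in> P. \<pi> (Suc i) < \<pi> i}"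
  have \<tau>: "\<tau> permutes {..<l}" using i by (simp add: \<tau>_def permutes_swap_id)
  have \<tau>\<tau>: "\<pi> \<circ> \<tau> \<circ> \<tau> = \<pi>" for \<pi> :: "nat \<Rightarrow> nat" by (simp add: \<tau>_def comp_assoc)
  have P: "\<pi> \<circ> \<tau> \<in> P" if "\<pi> \<in> P" for \<pi>
    using that \<tau> permutes_compose by (auto simp: P_def)
  have neg: "t (\<pi> \<circ> \<tau>) = - t \<pi>" if "\<pi> \<in> P" for \<pi>
  proof -
    have \<pi>: "\<pi> permutes {..<l}" using that by (simp add: P_def)
    have lt: "\<pi> i < l" "\<pi> (Suc i) < l"
      using permutes_in_image[OF \<pi>, of i] permutes_in_image[OF \<pi>, of "Suc i"] i by auto
    have sg: "sign (\<pi> \<circ> \<tau>) = - sign \<pi>"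
      using \<pi> \<tau> by (subst sign_compose) (auto simp: \<tau>_def sign_swap_id intro: permutes_imp_permutation)
    have split: "prod_list (map f [0..<l])
      = prod_list (map f [0..<i]) * (f i * f (Suc i) * prod_list (map f [Suc (Suc i)..<l]))" for f :: "nat \<Rightarrow> 'a"
      using i upt_conv_Cons[of "Suc i" l] by (simp add: prod_list_upt_split[of i l] mult.assoc)
    have outer: "map (\<lambda>j. g j ((\<pi> \<circ> \<tau>) j)) [0..<i] = map (\<lambda>j. g j (\<pi> j)) [0..<i]"
      "map (\<lambda>j. g j ((\<pi> \<circ> \<tau>) j)) [Suc (Suc i)..<l] = map (\<lambda>j. g j (\<pi> j)) [Suc (Suc i)..<l]"
      by (auto simp: \<tau>_def transpose_def)
    have "g i ((\<pi> \<circ> \<tau>) i) * g (Suc i) ((\<pi> \<circ> \<tau>) (Suc i)) = g i (\<pi> i) * g (Suc i) (\<pi> (Suc i))"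
      using sym[OF lt] by (simp add: \<tau>_def)
    then show ?thesis
      unfolding t_def split outer sg by simp
  qed
  have fin: "finite P" unfolding P_def by (rule finite_permutations) simp
  have "sum t B = (\<Sum>\<pi>\<in>A. t (\<pi> \<circ> \<tau>))"
    by (rule sum.reindex_bij_witness[of _ "\<lambda>\<pi>. \<pi> \<circ> \<tau>" "\<lambda>\<pi>. \<pi> \<circ> \<tau>"])
      (auto simp: A_def B_def P \<tau>\<tau>, auto simp: \<tau>_def)
  also have "\<dots> = - sum t A" by (simp add: A_def neg sum_negf)
  finally have "sum t A + sum t B = 0" by simp
  moreover have "P = A \<union> B"
  proof -
    have "\<pi> i \<noteq> \<pi> (Suc i)" if "\<pi> \<in> P" for \<pi>
      using that inj_eq[OF permutes_inj[of \<pi> "{..<l}"], of i "Suc i"] by (simp add: P_def)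
    then have "\<pi> \<in> A \<union> B" if "\<pi> \<in> P" for \<pi>
      using that linorder_neq_iff[of "\<pi> i" "\<pi> (Suc i)"] by (auto simp: A_def B_def)
    then show ?thesis by (auto simp: A_def B_def)
  qed
  moreover have "sum t (A \<union> B) = sum t A + sum t B"
    using fin by (intro sum.union_disjoint) (auto simp: A_def B_def)
  ultimately show ?thesis by (simp add: ndet_def t_def P_def)
qed

lemma ndet_upper_triangular:
  assumes "\<And>j p. j < l \<Longrightarrow> p < j \<Longrightarrow> g j p = 0"
  shows "ndet l g = prod_list (map (\<lambda>j. g j j) [0..<l])"
proof -
  define t where "t \<pi> = of_int (sign \<pi>) * prod_list (map (\<lambda>j. g j (\<pi> j)) [0..<l])" for \<pi>
  have "t \<pi> = 0" if \<pi>: "\<pi> permutes {..<l}" "\<pi> \<noteq> id" for \<pi>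
  proof -
    obtain j where "j < l" "\<pi> j < j"
      using permutes_natset_ge[OF \<pi>(1)] \<pi>(2) by (meson lessThan_iff not_le)
    then show ?thesis using assms by (simp add: t_def prod_list_upt_split[of j l])
  qed
  then have "sum t {\<pi>. \<pi> permutes {..<l}} = sum t {id}"
    by (intro sum.mono_neutral_right) (auto simp: finite_permutations permutes_id)
  then show ?thesis by (simp add: ndet_def t_def)
qed

section \<open>Sliding a column into its left neighbour\<close>

context plac_algebra
begin

text \<open>A mixture of \<open>uw_slide\<close> and \<open>e_slide\<close>: the upper letters
  \<open>w\<close> of the chain are fixed, the tail ranges over all chains of
  \<open>T\<close>.\<close>

lemma uw_e_slide:
  assumes "sorted_wrt (>) w" "lower_order_ideal T" "\<not> n < b"
    and "\<And>z. z \<in> set w \<Longrightarrow> z < b \<and> z < n"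
    and "\<And>y. y \<in> T \<Longrightarrow> y < b \<and> y < n \<and> (\<forall>z\<in>set w. y < z)"
  shows "u b * uw w * e k T * u n = u b * u n * uw w * e k T"
  using assms
proof (induction w arbitrary: b)
  case Nil
  then show ?case using e_slide[of T b n k] by simp
next
  case (Cons x w)
  have x: "x < b" "x < n" using Cons.prems(4) by auto
  then have "\<not> n < x" by (blast dest: order.asym)
  then have "u x * uw w * e k T * u n = u x * u n * uw w * e k T"
    using Cons.prems by (intro Cons.IH) simp_all
  moreover have "u b * u x * u n = u b * u n * u x"
    using x Cons.prems(3) by (intro rel1)
  ultimately show ?case
    by (simp add: mult.assoc mult3_extend[of "u b" "u x" "u n" "u b" "u n" "u x"])
qed

text \<open>\<open>P\<close> starts one row above \<open>Q\<close>. By freeness,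
  \<open>P ! s\<close> for \<open>s < t\<close> and all of \<open>T\<close> lie below
  \<open>Q ! t\<close>, so each \<open>Q ! t\<close> slides left until it stands behind
  \<open>P ! t\<close>. That \<open>M\<close> is chosen before \<open>k\<close> makes the product of
  two neighbouring rows symmetric in their degrees.\<close>

lemma uw_merge_columns:
  assumes P: "sorted_wrt (<) P" "length Q < length P"
    and rows: "\<And>s. s < length Q \<Longrightarrow> \<not> Q ! s < P ! Suc s"
  shows "\<exists>M. \<forall>k. uw (rev P) * e k {..<P ! 0} * uw (rev Q) = M * e k {..<P ! 0}"
proof -
  define T where "T = {..<P ! 0}"
  have P_less: "P ! s < P ! t" if "s < t" "t < length P" for s t
    using sorted_wrt_nth_less[OF P(1)] that by auto
  have T_less: "y < P ! t" if "y \<in> T" "t < length P" for y t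
    using that P_less[of 0 t] by (cases t) (auto simp: T_def)
  have P_Q: "P ! s < Q ! t" if "s < t" "t < length Q" for s t
    using three_chain_comparable[OF free31 P_less[of s t] P_less[of t "Suc t"] rows[of t]] that P(2)
    by simp
  have T_Q: "y < Q ! t" if "y \<in> T" "t < length Q" for y t
    using three_chain_comparable[OF free31 T_less[of y t] P_less[of t "Suc t"] rows[of t]] that P(2)
    by simp
  have Q_P: "\<not> Q ! t < P ! t" if "t < length Q" for t
    using order.strict_trans[OF _ P_less[of t "Suc t"], of "Q ! t"] rows[of t] that P(2) by auto
  have "\<exists>M. \<forall>k. uw (rev (take t P)) * e k T * uw (rev (take t Q)) = M * e k T"
    if "t \<le> length Q" for t
    using that
  proof (induction t)
    case 0
    then show ?case by (intro exI[of _ 1]) simp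
  next
    case (Suc t)
    then obtain M where M: "uw (rev (take t P)) * e k T * uw (rev (take t Q)) = M * e k T" for k
      by auto
    have t: "t < length Q" "t < length P" using Suc.prems P(2) by auto
    have in_take: "\<exists>s<t. z = P ! s" if "z \<in> set (take t P)" for z
      using that t by (auto simp: in_set_conv_nth)
    have "u (P ! t) * uw (rev (take t P)) * e k T * u (Q ! t)
        = u (P ! t) * u (Q ! t) * uw (rev (take t P)) * e k T" for k
    proof (rule uw_e_slide)
      show "sorted_wrt (>) (rev (take t P))"
        using P(1) by (simp add: sorted_wrt_rev sorted_wrt_take)
      show "lower_order_ideal T" by (simp add: T_def lower_ideal_below)
      show "\<not> Q ! t < P ! t" using Q_P t by simp
      show "z < P ! t \<and> z < Q ! t" if "z \<in> set (rev (take t P))" for z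
        using that in_take[of z] P_less P_Q t by auto
      show "y < P ! t \<and> y < Q ! t \<and> (\<forall>z\<in>set (rev (take t P)). y < z)" if "y \<in> T" for y
        using that T_less T_Q t by (auto dest!: in_take)
    qed
    then have "uw (rev (take (Suc t) P)) * e k T * uw (rev (take (Suc t) Q))
       = (u (P ! t) * u (Q ! t) * M) * e k T" for k
      using M[of k] t by (simp add: take_Suc_conv_app_nth flip: mult.assoc) (simp add: mult.assoc)
    then show ?case by blast
  qed
  from this[of "length Q"]
  obtain M where M: "\<And>k. uw (rev (take (length Q) P)) * e k T * uw (rev Q) = M * e k T" by auto
  have "uw (rev P) = uw (rev (drop (length Q) P)) * uw (rev (take (length Q) P))"
    by (metis append_take_drop_id rev_append uw_simps(3))
  then show ?thesis
    using M by (intro exI[of _ "uw (rev (drop (length Q) P)) * M"]) (simp add: T_def mult.assoc)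
qed

end

section \<open>Expansion of the flagged determinant over tableaux\<close>

locale flagged_shape = plac_algebra u for u :: "'a::{finite,order} \<Rightarrow> 'r::ring_1" +
  fixes \<alpha> :: "nat list" and Z :: "'a set list"
  assumes part: "sorted_wrt (\<ge>) \<alpha>"
    and len_Z: "length Z = length \<alpha>"
    and Z_low: "i < length Z \<Longrightarrow> lower_order_ideal (Z ! i)"
    and Z_mono: "Suc i < length Z \<Longrightarrow> Z ! i \<subseteq> Z ! Suc i"
begin

abbreviation "l \<equiv> length \<alpha>"

text \<open>Fillings of the boxes of \<open>\<alpha>'\<close> in rows \<open>\<ge> r j\<close> of each column \<open>j\<close>; the entry in row \<open>s\<close>
  of column \<open>j\<close> is \<open>F ! j ! (s - r j)\<close>.\<close>

definition fills :: "(nat \<Rightarrow> nat) \<Rightarrow> 'a list list set" where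
  "fills r = {F. length F = l
     \<and> (\<forall>j<l. length (F ! j) = \<alpha> ! j - r j \<and> sorted_wrt (<) (F ! j) \<and> set (F ! j) \<subseteq> Z ! j)
     \<and> (\<forall>j s. Suc j < l \<longrightarrow> r j \<le> s \<longrightarrow> r (Suc j) \<le> s \<longrightarrow> s < \<alpha> ! j \<longrightarrow> s < \<alpha> ! Suc j \<longrightarrow>
          \<not> F ! Suc j ! (s - r (Suc j)) < F ! j ! (s - r j))}"

definition avail :: "'a list list \<Rightarrow> nat \<Rightarrow> 'a set" where
  "avail F j = {z \<in> Z ! j. \<forall>x\<in>set (F ! j). z < x}"

text \<open>The letters already placed in column \<open>j\<close>, read upwards, followed by all
  ways to continue the chain above them. For \<open>r j = \<alpha> ! j\<close> it is the original
  row, for \<open>r = (\<lambda>_. 0)\<close> the matrix is upper triangular.\<close>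

definition entry :: "(nat \<Rightarrow> nat) \<Rightarrow> 'a list list \<Rightarrow> nat \<Rightarrow> nat \<Rightarrow> 'r" where
  "entry r F j p = uw (rev (F ! j)) * e (int (r j) + int p - int j) (avail F j)"

definition weight :: "(nat \<Rightarrow> nat) \<Rightarrow> 'r" where
  "weight r = (\<Sum>F\<in>fills r. ndet l (entry r F))"

text \<open>It is applied when column \<open>i - 1\<close> already reaches one row higher, so that
  its first recorded entry is the left neighbour of the new box.\<close>

definition choices :: "'a list list \<Rightarrow> nat \<Rightarrow> 'a set" where
  "choices F i = {x \<in> avail F i. i = 0 \<or> \<not> x < F ! (i - 1) ! 0}"

lemma finite_fills: "finite (fills r)"
proof (rule finite_subset)
  define N where "N = Max ((\<lambda>j. \<alpha> ! j - r j) ` {..<l})"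
  show "fills r \<subseteq> {F. set F \<subseteq> {w. set w \<subseteq> UNIV \<and> length w \<le> N} \<and> length F = l}"
    by (force simp: fills_def N_def in_set_conv_nth intro: Max_ge)
  show "finite {F :: 'a list list. set F \<subseteq> {w. set w \<subseteq> UNIV \<and> length w \<le> N} \<and> length F = l}"
    by (intro finite_lists_length_eq finite_lists_length_le) simp
qed

lemma fills_cong:
  assumes "\<And>j. j < l \<Longrightarrow> r j = r' j"
  shows "fills r = fills r'"
proof -
  have "Suc j < l \<Longrightarrow> r j = r' j" "Suc j < l \<Longrightarrow> r (Suc j) = r' (Suc j)" for j
    using assms by auto
  then show ?thesis unfolding fills_def using assms by (intro Collect_cong conj_cong refl) auto
qed

lemma weight_cong:
  assumes "\<And>j. j < l \<Longrightarrow> r j = r' j"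
  shows "weight r = weight r'"
  unfolding weight_def using assms
  by (intro sum.cong fills_cong ndet_cong) (auto simp: entry_def)

lemma fills_col:
  "F \<in> fills r \<Longrightarrow> j < l \<Longrightarrow> length (F ! j) = \<alpha> ! j - r j \<and> sorted_wrt (<) (F ! j) \<and> set (F ! j) \<subseteq> Z ! j"
  by (simp add: fills_def)

lemma fills_row:
  "F \<in> fills r \<Longrightarrow> Suc j < l \<Longrightarrow> r j \<le> s \<Longrightarrow> r (Suc j) \<le> s \<Longrightarrow> s < \<alpha> ! j \<Longrightarrow> s < \<alpha> ! Suc j \<Longrightarrow>
    \<not> F ! Suc j ! (s - r (Suc j)) < F ! j ! (s - r j)"
  by (simp add: fills_def)

lemma \<alpha>_mono: "Suc j < l \<Longrightarrow> \<alpha> ! Suc j \<le> \<alpha> ! j"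
  using sorted_wrt_nth_less[OF part, of j "Suc j"] by simp

lemma avail_lower: "j < l \<Longrightarrow> lower_order_ideal (avail F j)"
  using Z_low[of j] len_Z unfolding lower_order_ideal_def avail_def
  by (auto intro: order.strict_trans)

lemma avail_cons:
  assumes "i < length F" "i < l" "x \<in> avail F i"
  shows "avail (F[i := x # F ! i]) i = {..<x}"
  using assms Z_low[of i] len_Z unfolding lower_order_ideal_def avail_def
  by (auto intro: order.strict_trans)

text \<open>Split row \<open>i\<close> by whether the chain lies in \<open>T\<close>, the set of
  letters below the left neighbour. The chains in \<open>T\<close> give a determinant whose rows
  \<open>i - 1\<close> and \<open>i\<close> carry elementary functions of the same set in the same
  degrees, so it vanishes by \<open>uw_merge_columns\<close> and \<open>e_commute\<close>. Any other
  chain has its top in \<open>S - T\<close>, and this top is the new entry.\<close>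

lemma ndet_fill_box:
  assumes F: "F \<in> fills r" and i: "i < l" and ri: "r i = Suc \<rho>" "Suc \<rho> \<le> \<alpha> ! i"
    and left: "0 < i \<Longrightarrow> r (i - 1) = \<rho>"
  shows "ndet l (entry r F) = (\<Sum>x\<in>choices F i. ndet l (entry (r(i := \<rho>)) (F[i := x # F ! i])))"
proof -
  define k where "k p = int (Suc \<rho>) + int p - int i" for p
  define S where "S = avail F i"
  define T where "T = (if i = 0 then {} else {..<F ! (i - 1) ! 0})"
  \<comment> \<open>Column \<open>0\<close> has no left neighbour; there \<open>k p\<close> is
    positive, so no constant term occurs and this row is zero.\<close>
  define g0 where "g0 j p = (if j = i then (if i = 0 then 0 else uw (rev (F ! i)) * e (k p) T) else entry r F j p)" for j p
  have lF: "length F = l" using F by (simp add: fills_def)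
  have S: "lower_order_ideal S" unfolding S_def by (rule avail_lower[OF i])
  have T: "lower_order_ideal T" by (auto simp: T_def lower_order_ideal_def)
  have "T \<subseteq> S \<and> ndet l g0 = 0"
  proof (cases i)
    case 0
    then show ?thesis using i by (auto simp: T_def g0_def intro: ndet_zero_row[of 0])
  next
    case (Suc h)
    define P Q where "P = F ! h" and "Q = F ! i"
    have P: "length P = \<alpha> ! h - \<rho>" "sorted_wrt (<) P" "set P \<subseteq> Z ! h"
      and Q: "length Q = \<alpha> ! i - Suc \<rho>"
      using fills_col[OF F, of h] fills_col[OF F, of i] i ri left Suc by (auto simp: P_def Q_def)
    have less: "length Q < length P" using P(1) Q ri \<alpha>_mono[of h] i Suc by simp
    have T_def': "T = {..<P ! 0}" by (simp add: T_def P_def Suc)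
    have "P ! 0 \<in> set P" using less by (intro nth_mem) auto
    then have P0: "P ! 0 \<in> Z ! h" using P(3) by auto
    have rows: "\<not> Q ! s < P ! Suc s" if "s < length Q" for s
    proof -
      have "s + Suc \<rho> < \<alpha> ! i" using that Q by simp
      then have "\<not> F ! Suc h ! (s + Suc \<rho> - r (Suc h)) < F ! h ! (s + Suc \<rho> - r h)"
        using \<alpha>_mono[of h] i Suc ri left by (intro fills_row[OF F]) auto
      then show ?thesis using ri left Suc by (simp add: P_def Q_def)
    qed
    have "T \<subseteq> S"
    proof
      fix y assume "y \<in> T"
      then have y: "y < P ! 0" by (simp add: T_def')
      have "y \<in> Z ! h" using y P0 Z_low[of h] len_Z i Suc by (auto simp: lower_order_ideal_def)
      then have "y \<in> Z ! i" using Z_mono[of h] len_Z i Suc by auto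
      \<comment> \<open>Freeness is applied to the chain \<open>y < P ! 0 < P ! Suc t\<close> and
        the element \<open>Q ! t\<close>.\<close>
      moreover have "y < Q ! t" if "t < length Q" for t
        using three_chain_comparable[OF free31 y sorted_wrt_nth_less[OF P(2), of 0 "Suc t"] rows[OF that]]
          that less by simp
      ultimately show "y \<in> S" by (auto simp: S_def avail_def Q_def in_set_conv_nth)
    qed
    moreover have "ndet l g0 = 0"
    proof (rule ndet_adjacent_symmetric)
      show "Suc h < l" using i Suc by simp
      have "avail F h = T"
      proof -
        have "y < x" if "y < P ! 0" "x \<in> set P" for x y
        proof -
          obtain t where "t < length P" "x = P ! t" using \<open>x \<in> set P\<close> by (auto simp: in_set_conv_nth)
          then show ?thesis
            using that(1) sorted_wrt_nth_less[OF P(2), of 0 t] by (cases t) auto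
        qed
        moreover have "y \<in> Z ! h" if "y < P ! 0" for y
          using that P0 Z_low[of h] len_Z i Suc by (auto simp: lower_order_ideal_def)
        moreover note \<open>P ! 0 \<in> set P\<close>
        ultimately show ?thesis unfolding avail_def T_def' P_def[symmetric] by auto
      qed
      \<comment> \<open>The degrees agree with \<open>k p\<close> because both \<open>r\<close> and
        the column index are smaller by one at \<open>h\<close> than at \<open>i\<close>.\<close>
      then have gh: "g0 h p = uw (rev P) * e (k p) T" for p
        using Suc left by (simp add: g0_def entry_def P_def k_def add_diff_eq)
      have gi: "g0 (Suc h) p = uw (rev Q) * e (k p) T" for p
        using Suc by (simp add: g0_def Q_def)
      obtain M where "\<And>k. uw (rev P) * e k T * uw (rev Q) = M * e k T"
        using uw_merge_columns[OF P(2) less rows] unfolding T_def' by blast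
      then have "g0 h p * g0 (Suc h) q = M * (e (k p) T * e (k q) T)" for p q
        by (simp add: gh gi flip: mult.assoc)
      then show "g0 h p * g0 (Suc h) q = g0 h q * g0 (Suc h) p" for p q
        using e_commute[OF T] by simp
    qed
    ultimately show ?thesis by simp
  qed
  moreover have "S - T = choices F i"
    by (auto simp: S_def T_def choices_def)
  moreover have "ndet l (entry r F)
     = ndet l g0 + (\<Sum>x\<in>S - T. ndet l (entry (r(i := \<rho>)) (F[i := x # F ! i])))"
  proof (rule ndet_row_add_sum[OF i])
    show "g0 j p = entry r F j p" if "j \<noteq> i" for j p using that by (simp add: g0_def)
    show "entry (r(i := \<rho>)) (F[i := x # F ! i]) j p = entry r F j p" if "j \<noteq> i" for x j p
      using that by (simp add: entry_def avail_def)
    fix p assume "p < l"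
    have "entry (r(i := \<rho>)) (F[i := x # F ! i]) i p = uw (rev (F ! i)) * (u x * e (k p - 1) {..<x})"
      if "x \<in> S - T" for x
      using that i lF by (simp add: entry_def avail_cons S_def k_def mult.assoc add_diff_eq)
    moreover have "entry r F i p = g0 i p + uw (rev (F ! i)) * (\<Sum>x\<in>S - T. u x * e (k p - 1) {..<x})"
    proof (cases "i = 0")
      case True
      then show ?thesis
        using e_rec[OF S, of "k p"] ri(1) by (simp add: entry_def g0_def T_def S_def k_def ri)
    next
      case False
      then show ?thesis
        using e_split[OF S T, of "k p"] \<open>T \<subseteq> S \<and> _\<close>
        by (simp add: entry_def g0_def S_def k_def ri distrib_left)
    qed
    ultimately show "entry r F i p = g0 i p + (\<Sum>x\<in>S - T. entry (r(i := \<rho>)) (F[i := x # F ! i]) i p)"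
      by (simp add: sum_distrib_left)
  qed
  ultimately show ?thesis by simp
qed

text \<open>Sum \<open>ndet_fill_box\<close> over all fillings; putting a letter on top of column
  \<open>i\<close> is a bijection onto the fillings of the enlarged region. By \<open>right\<close>,
  the right neighbour of the new box is missing or still empty, so the only new row condition is the
  one in \<open>choices\<close>.\<close>

lemma weight_fill_box:
  assumes i: "i < l" and ri: "r i = Suc \<rho>" "Suc \<rho> \<le> \<alpha> ! i"
    and left: "0 < i \<Longrightarrow> r (i - 1) = \<rho>"
    and right: "Suc i < l \<Longrightarrow> min (\<alpha> ! Suc i) (Suc \<rho>) \<le> r (Suc i)"
  shows "weight r = weight (r(i := \<rho>))"
proof -
  define r' where "r' = r(i := \<rho>)"
  have ins: "F[i := x # F ! i] \<in> fills r'" if F: "F \<in> fills r" and x: "x \<in> choices F i" for F x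
  proof -
    have lF: "length F = l" using F by (simp add: fills_def)
    have "\<not> F[i := x # F ! i] ! Suc j ! (s - r' (Suc j)) < F[i := x # F ! i] ! j ! (s - r' j)"
      if js: "Suc j < l" "r' j \<le> s" "r' (Suc j) \<le> s" "s < \<alpha> ! j" "s < \<alpha> ! Suc j" for j s
    proof -
      \<comment> \<open>Only the first case is new; the others repeat an old row condition, with
        list indices shifted by one in column \<open>i\<close>.\<close>
      consider "Suc j = i" "s = \<rho>" | "Suc j = i" "s > \<rho>" | "j = i" | "Suc j \<noteq> i" "j \<noteq> i"
        using js(3) by (fastforce simp: r'_def)
      then show ?thesis
      proof cases
        case 1
        then show ?thesis using x left i lF by (auto simp: r'_def choices_def)
      next
        case 2
        then show ?thesis using fills_row[OF F js(1), of s] js left i lF ri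
          by (simp add: r'_def nth_Cons' Suc_le_eq)
      next
        case 3
        then have "Suc \<rho> \<le> s" using right js by (auto simp: r'_def)
        then show ?thesis using fills_row[OF F js(1), of s] js left i lF ri 3
          by (simp add: r'_def nth_Cons' Suc_le_eq)
      next
        case 4
        then show ?thesis using fills_row[OF F js(1), of s] js by (simp add: r'_def)
      qed
    qed
    then show ?thesis
      using fills_col[OF F] lF i ri x
      by (auto simp: fills_def r'_def nth_list_update choices_def avail_def)
  qed
  have del: "F[i := tl (F ! i)] \<in> fills r \<and> hd (F ! i) \<in> choices (F[i := tl (F ! i)]) i \<and> F ! i \<noteq> []"
    if F: "F \<in> fills r'" for F
  proof -
    have lF: "length F = l" using F by (simp add: fills_def)
    have Fi: "length (F ! i) = \<alpha> ! i - \<rho>" "sorted_wrt (<) (F ! i)" "set (F ! i) \<subseteq> Z ! i"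
      using fills_col[OF F i] by (simp_all add: r'_def)
    then have ne: "F ! i \<noteq> []" using ri by auto
    then obtain y ys where ys: "F ! i = y # ys" by (cases "F ! i") auto
    have "\<not> F[i := tl (F ! i)] ! Suc j ! (s - r (Suc j)) < F[i := tl (F ! i)] ! j ! (s - r j)"
      if js: "Suc j < l" "r j \<le> s" "r (Suc j) \<le> s" "s < \<alpha> ! j" "s < \<alpha> ! Suc j" for j s
    proof -
      consider "Suc j = i" | "j = i" | "Suc j \<noteq> i" "j \<noteq> i" by blast
      then show ?thesis
        using fills_row[OF F js(1), of s] js lF ri ys
        by cases (simp_all add: r'_def nth_Cons' Suc_le_eq)
    qed
    then have "F[i := tl (F ! i)] \<in> fills r"
      using fills_col[OF F] Fi[unfolded ys] lF i ri ys
      by (auto simp: fills_def r'_def nth_list_update split: if_splits)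
    moreover have "i = 0 \<or> \<not> y < F ! (i - 1) ! 0"
      using fills_row[OF F, of "i - 1" \<rho>] i ri left ys \<alpha>_mono[of "i - 1"]
      by (cases i) (auto simp: r'_def)
    then have "hd (F ! i) \<in> choices (F[i := tl (F ! i)]) i"
      using Fi ys lF i by (auto simp: choices_def avail_def nth_list_update)
    ultimately show ?thesis using ne by simp
  qed
  have "weight r = (\<Sum>F\<in>fills r. \<Sum>x\<in>choices F i. ndet l (entry r' (F[i := x # F ! i])))"
    unfolding weight_def r'_def by (intro sum.cong refl ndet_fill_box[OF _ i ri left])
  also have "\<dots> = (\<Sum>(F, x)\<in>(SIGMA F:fills r. choices F i). ndet l (entry r' (F[i := x # F ! i])))"
    by (rule sum.Sigma) (auto simp: finite_fills)
  also have "\<dots> = (\<Sum>F\<in>fills r'. ndet l (entry r' F))"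
  proof (rule sum.reindex_bij_witness[of _ "\<lambda>F. (F[i := tl (F ! i)], hd (F ! i))" "\<lambda>(F, x). F[i := x # F ! i]"])
    fix F assume "F \<in> fills r'"
    then show "(case (F[i := tl (F ! i)], hd (F ! i)) of (F, x) \<Rightarrow> F[i := x # F ! i]) = F"
      using del[of F] i by (auto simp: fills_def)
  qed (use ins del i in \<open>auto simp: fills_def\<close>)
  finally show ?thesis by (simp add: weight_def r'_def)
qed

lemma weight_fill_row:
  "weight (\<lambda>j. min (\<alpha> ! j) (Suc n)) = weight (\<lambda>j. min (\<alpha> ! j) n)"
proof -
  \<comment> \<open>The columns left of \<open>i\<close> already have their box in row
    \<open>n\<close> filled; columns without such a box are left alone by the
    \<open>min\<close>.\<close>
  define r where "r i j = min (\<alpha> ! j) (if j < i then n else Suc n)" for i j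
  have "weight (r i) = weight (r (Suc i))" if "i < l" for i
  proof (cases "Suc n \<le> \<alpha> ! i")
    case True
    have "weight (r i) = weight ((r i)(i := n))"
      using True that \<alpha>_mono[of "i - 1"] by (intro weight_fill_box) (auto simp: r_def)
    also have "(r i)(i := n) = r (Suc i)"
      using True by (auto simp: r_def fun_eq_iff less_Suc_eq)
    finally show ?thesis .
  next
    case False
    then have "r i = r (Suc i)" by (auto simp: r_def fun_eq_iff less_Suc_eq)
    then show ?thesis by simp
  qed
  then have "weight (r 0) = weight (r i)" if "i \<le> l" for i
    using that by (induction i) auto
  from this[of l] have "weight (r 0) = weight (r l)" by simp
  also have "weight (r l) = weight (\<lambda>j. min (\<alpha> ! j) n)"
    by (rule weight_cong) (simp add: r_def)
  also have "r 0 = (\<lambda>j. min (\<alpha> ! j) (Suc n))" by (simp add: r_def fun_eq_iff)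
  finally show ?thesis .
qed

lemma weight_eq: "weight (\<lambda>j. \<alpha> ! j) = weight (\<lambda>_. 0)"
proof -
  have "weight (\<lambda>j. min (\<alpha> ! j) n) = weight (\<lambda>_. 0)" for n
    by (induction n) (simp_all add: weight_fill_row)
  from this[of "sum_list \<alpha>"] show ?thesis
    using weight_cong[of "\<lambda>j. min (\<alpha> ! j) (sum_list \<alpha>)" "\<lambda>j. \<alpha> ! j"]
    by (simp add: elem_le_sum_list min_absorb1)
qed

lemma SSYT_eq_fills: "SSYT_Z \<alpha> Z = fills (\<lambda>_. 0)"
proof (intro set_eqI)
  fix T :: "'a list list"
  have *: "sorted_wrt (<) w \<longleftrightarrow> (\<forall>s. Suc s < length w \<longrightarrow> w ! s < w ! Suc s)" for w :: "'a list"
    by (rule sorted_wrt_iff_nth_Suc_transp) (auto intro: transpI)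
  show "T \<in> SSYT_Z \<alpha> Z \<longleftrightarrow> T \<in> fills (\<lambda>_. 0)"
    unfolding SSYT_Z_def fills_def mem_Collect_eq * minus_nat.diff_0 by (auto simp del: length_greater_0_conv)
qed

lemma weight_empty: "weight (\<lambda>j. \<alpha> ! j) = ndet l (\<lambda>j p. e (int (\<alpha> ! j) + int p - int j) (Z ! j))"
proof -
  have "fills (\<lambda>j. \<alpha> ! j) = {replicate l []}"
  proof -
    have "F = replicate l []" if "length F = l" "\<forall>j<l. length (F ! j) = 0" for F :: "'a list list"
      using that by (intro nth_equalityI) auto
    then show ?thesis by (auto simp: fills_def)
  qed
  then have "weight (\<lambda>j. \<alpha> ! j) = ndet l (entry (\<lambda>j. \<alpha> ! j) (replicate l []))"
    by (simp add: weight_def)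
  also have "\<dots> = ndet l (\<lambda>j p. e (int (\<alpha> ! j) + int p - int j) (Z ! j))"
  proof (rule ndet_cong)
    fix j p assume "j < l"
    then have "avail (replicate l []) j = Z ! j" by (simp add: avail_def)
    then show "entry (\<lambda>j. \<alpha> ! j) (replicate l []) j p = e (int (\<alpha> ! j) + int p - int j) (Z ! j)"
      using \<open>j < l\<close> by (simp add: entry_def)
  qed
  finally show ?thesis .
qed

text \<open>When every box is filled, the entry at \<open>(j, p)\<close> has degree
  \<open>p - j\<close>: it is zero for \<open>p < j\<close> and is the column word for
  \<open>p = j\<close>, so only the identity permutation survives.\<close>

lemma weight_full: "weight (\<lambda>_. 0) = (\<Sum>T\<in>SSYT_Z \<alpha> Z. uw (concat (map rev T)))"
proof -
  have "ndet l (entry (\<lambda>_. 0) T) = uw (concat (map rev T))" if "T \<in> fills (\<lambda>_. 0)" for T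
  proof -
    have lT: "length T = l" using that by (simp add: fills_def)
    have "ndet l (entry (\<lambda>_. 0) T) = prod_list (map (\<lambda>j. uw (rev (T ! j))) [0..<l])"
      by (subst ndet_upper_triangular) (auto simp: entry_def)
    also have "map (\<lambda>j. uw (rev (T ! j))) [0..<l] = map (\<lambda>w. uw (rev w)) T"
      using lT by (intro nth_equalityI) auto
    also have "prod_list (map (\<lambda>w. uw (rev w)) xs) = uw (concat (map rev xs))" for xs
      by (induction xs) simp_all
    finally show ?thesis .
  qed
  then show ?thesis unfolding weight_def SSYT_eq_fills by (intro sum.cong refl)
qed

theorem ndet_eq_column_words:
  "ndet l (\<lambda>j p. e (int (\<alpha> ! j) + int p - int j) (Z ! j))
    = (\<Sum>T\<in>SSYT_Z \<alpha> Z. uw (concat (map rev T)))"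
  using weight_eq weight_empty weight_full by simp

end

section \<open>Column words and diagonal words\<close>

text \<open>Free of \<open>\<alpha>\<close> and \<open>Z\<close>, so that it passes to the list of
  columns without the first one.\<close>

definition tableau :: "'a::order list list \<Rightarrow> bool" where
  "tableau T \<longleftrightarrow> sorted_wrt (\<ge>) (map length T) \<and> (\<forall>w\<in>set T. sorted_wrt (<) w)
     \<and> (\<forall>j r. Suc j < length T \<longrightarrow> r < length (T ! Suc j) \<longrightarrow> \<not> T ! Suc j ! r < T ! j ! r)"

definition diagonal :: "nat \<Rightarrow> 'a list list \<Rightarrow> int \<Rightarrow> 'a list" where
  "diagonal N T d = map (\<lambda>r. T ! nat (int r + d) ! r)
     (filter (\<lambda>r. 0 \<le> int r + d \<and> nat (int r + d) < length T \<and> r < length (T ! nat (int r + d))) [0..<N])"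

lemma diagword_eq_concat_diagonal:
  "diagword (map length T) T
    = concat (map (diagonal (sum_list (map length T)) T) [- int (sum_list (map length T)) .. int (length T)])"
proof -
  have "filter (\<lambda>r. 0 \<le> int r + d \<and> nat (int r + d) < length T \<and> r < map length T ! nat (int r + d)) xs
    = filter (\<lambda>r. 0 \<le> int r + d \<and> nat (int r + d) < length T \<and> r < length (T ! nat (int r + d))) xs" for d xs
    by (intro filter_cong refl) auto
  then show ?thesis
    unfolding diagword_def diag_boxes_def diagonal_def map_concat map_map comp_def by simp
qed

text \<open>A new first column meets diagonal \<open>d\<close> in at most one box, in row
  \<open>- d\<close>, and this box is read first. The old columns move one step to the right, whence
  \<open>d - 1\<close>.\<close>

lemma diagonal_Cons:
  assumes "length C \<le> N"
  shows "diagonal N (C # T) d = (if d \<le> 0 \<and> nat (- d) < length C then [C ! nat (- d)] else []) @ diagonal N T (d - 1)"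
proof -
  define P where "P r \<longleftrightarrow> 0 \<le> int r + d \<and> nat (int r + d) < length (C # T) \<and> r < length ((C # T) ! nat (int r + d))" for r
  define Q where "Q r \<longleftrightarrow> 0 \<le> int r + (d - 1) \<and> nat (int r + (d - 1)) < length T \<and> r < length (T ! nat (int r + (d - 1)))" for r
  define f where "f r = (C # T) ! nat (int r + d) ! r" for r
  define g where "g r = T ! nat (int r + (d - 1)) ! r" for r
  have nat_Suc: "nat (int r + d) = Suc (nat (int r + (d - 1)))" if "0 < int r + d" for r
    using that by linarith
  have PQ: "P r \<longleftrightarrow> Q r" "f r = g r" if "0 < int r + d" for r
    using nat_Suc[OF that] that by (auto simp: P_def Q_def f_def g_def)
  have after: "map f (filter P xs) = map g (filter Q xs)" if "\<forall>r\<in>set xs. 0 < int r + d" for xs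
    using that by (induction xs) (auto simp: PQ)
  have before: "map f (filter P xs) = []" "map g (filter Q xs) = []" if "\<forall>r\<in>set xs. int r + d < 0" for xs
    using that by (auto simp: P_def Q_def filter_empty_conv)
  have "map f (filter P [0..<N]) = (if d \<le> 0 \<and> nat (- d) < length C then [C ! nat (- d)] else []) @ map g (filter Q [0..<N])"
  proof (cases "d \<le> 0 \<and> nat (- d) < N")
    case True
    define m where "m = nat (- d)"
    have m: "int m + d = 0" "m < N" using True by (auto simp: m_def)
    have split: "[0..<N] = [0..<m] @ m # [Suc m..<N]"
      using m(2) upt_add_eq_append[of 0 m "N - m"] upt_conv_Cons[of m N] by simp
    have "map f (filter P [m]) = (if m < length C then [C ! m] else [])" "map g (filter Q [m]) = []"
      using m(1) by (auto simp: P_def Q_def f_def)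
    moreover have "map f (filter P [0..<m]) = []" "map g (filter Q [0..<m]) = []"
      using m(1) by (intro before; auto)+
    moreover have "map f (filter P [Suc m..<N]) = map g (filter Q [Suc m..<N])"
      using m(1) by (intro after) auto
    moreover have "map f (filter P [0..<N]) = map f (filter P [0..<m]) @ map f (filter P [m]) @ map f (filter P [Suc m..<N])"
      "map g (filter Q [0..<N]) = map g (filter Q [0..<m]) @ map g (filter Q [m]) @ map g (filter Q [Suc m..<N])"
      unfolding split by simp_all
    ultimately show ?thesis using True by (simp add: m_def)
  next
    case False
    show ?thesis
    proof (cases "d \<le> 0")
      case True
      then have "map f (filter P [0..<N]) = []" "map g (filter Q [0..<N]) = []"
        using False by (intro before; auto)+
      then show ?thesis using True False assms by simp
    next
      case d: False
      then have "map f (filter P [0..<N]) = map g (filter Q [0..<N])"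
        by (intro after) auto
      then show ?thesis using d by simp
    qed
  qed
  moreover have "diagonal N (C # T) d = map f (filter P [0..<N])"
    unfolding diagonal_def P_def[abs_def] f_def[abs_def] ..
  moreover have "diagonal N T (d - 1) = map g (filter Q [0..<N])"
    unfolding diagonal_def Q_def[abs_def] g_def[abs_def] ..
  ultimately show ?thesis by simp
qed

lemma diagonal_empty:
  assumes "\<forall>w\<in>set T. length w \<le> k" "d \<le> - int k"
  shows "diagonal N T d = []"
proof -
  have "\<not> r < length (T ! nat (int r + d))" if "0 \<le> int r + d" "nat (int r + d) < length T" for r
  proof -
    have "length (T ! nat (int r + d)) \<le> k" using assms(1) nth_mem[OF that(2)] by blast
    then show ?thesis using that(1) assms(2) by linarith
  qed
  then show ?thesis by (auto simp: diagonal_def filter_empty_conv)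
qed

lemma map_add_upto: "map (\<lambda>i. i + k) [a..b] = [a + k..b + k]" for k :: int
  by (rule nth_equalityI) (simp_all add: nth_upto)

lemma upto_neg_eq_rev_upt: "[- int k..-1] = map (\<lambda>n. - int n) (rev [1..<Suc k])"
proof (induction k)
  case (Suc k)
  have "[- int (Suc k)..-1] = - int (Suc k) # [- int k..-1]"
    by (subst upto_rec1) auto
  then show ?case using Suc by simp
qed simp

text \<open>Diagonal \<open>- n\<close> of \<open>T\<close> becomes diagonal \<open>1 - n\<close> of
  \<open>C # T\<close>, headed by \<open>C ! (n - 1)\<close>; indexing both words by
  \<open>n\<close> makes them comparable. Diagonals of \<open>T\<close> from \<open>0\<close> on do
  not meet the new column, those up to \<open>- length C\<close> are empty.\<close>

lemma concat_diagonal_Cons: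
  assumes "length C \<le> N" "length C \<le> M" "\<forall>w\<in>set T. length w \<le> length C"
  shows "concat (map (diagonal N (C # T)) [- int M..int (Suc M')])
      = concat (map (\<lambda>n. C ! (n - 1) # diagonal N T (- int n)) (rev [1..<Suc (length C)]))
        @ concat (map (diagonal N T) [0..int M'])"
    and "concat (map (diagonal N T) [- int M..int M'])
      = concat (map (\<lambda>n. diagonal N T (- int n)) (rev [1..<Suc (length C)]))
        @ concat (map (diagonal N T) [0..int M'])"
proof -
  define k where "k = length C"
  have split: "[a..b] = [a..- int k - 1] @ [- int k..-1] @ [0..b]" if "a \<le> - int k" "0 \<le> b" for a b
    using upto_split1[of a "- int k" b] upto_split1[of "- int k" 0 b] that by simp
  have "diagonal N T d = []" if "d \<le> - int k" for d
    using diagonal_empty[OF assms(3)] that by (simp add: k_def)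
  then have empty: "concat (map (diagonal N T) [a..- int k - 1]) = []" for a by auto
  show "concat (map (diagonal N T) [- int M..int M'])
      = concat (map (\<lambda>n. diagonal N T (- int n)) (rev [1..<Suc (length C)]))
        @ concat (map (diagonal N T) [0..int M'])"
    using assms(2) by (simp add: split upto_neg_eq_rev_upt comp_def empty k_def[symmetric] del: upt_Suc)
  define h where "h d = (if d < 0 \<and> nat (- d) \<le> k then [C ! (nat (- d) - 1)] else []) @ diagonal N T d" for d
  have "[- int M..int (Suc M')] = map (\<lambda>i. i + 1) [- int M - 1..int M']"
    by (simp add: map_add_upto add.commute)
  moreover have "diagonal N (C # T) (d + 1) = h d" for d
  proof -
    have "(d + 1 \<le> 0 \<and> nat (- (d + 1)) < k) = (d < 0 \<and> nat (- d) \<le> k)" "nat (- (d + 1)) = nat (- d) - 1"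
      by auto
    then show ?thesis using diagonal_Cons[OF assms(1), of T "d + 1"] by (simp add: h_def k_def)
  qed
  ultimately have "concat (map (diagonal N (C # T)) [- int M..int (Suc M')])
     = concat (map h [- int M - 1..int M'])" by (simp add: comp_def)
  also have "\<dots> = concat (map h [- int M - 1..- int k - 1]) @ concat (map h [- int k..-1]) @ concat (map h [0..int M'])"
    using assms(2) by (simp add: split k_def)
  also have "concat (map h [- int M - 1..- int k - 1]) = []"
    using diagonal_empty[OF assms(3), of _ N] by (auto simp: h_def k_def)
  also have "map h [0..int M'] = map (diagonal N T) [0..int M']"
    by (auto simp: h_def)
  also have "map h [- int k..-1] = map (\<lambda>n. C ! (n - 1) # diagonal N T (- int n)) (rev [1..<Suc k])"
    unfolding upto_neg_eq_rev_upt map_map by (intro map_cong refl) (auto simp: h_def)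
  finally show "concat (map (diagonal N (C # T)) [- int M..int (Suc M')])
      = concat (map (\<lambda>n. C ! (n - 1) # diagonal N T (- int n)) (rev [1..<Suc (length C)]))
        @ concat (map (diagonal N T) [0..int M'])"
    by (simp add: k_def)
qed

section \<open>Order relations between the boxes of a tableau\<close>

lemma tableau_length_mono:
  "tableau T \<Longrightarrow> i \<le> j \<Longrightarrow> j < length T \<Longrightarrow> length (T ! j) \<le> length (T ! i)"
  using sorted_wrt_nth_less[of "(\<ge>)" "map length T" i j] by (cases "i = j") (auto simp: tableau_def)

lemma tableau_column_less:
  "tableau T \<Longrightarrow> j < length T \<Longrightarrow> r < s \<Longrightarrow> s < length (T ! j) \<Longrightarrow> T ! j ! r < T ! j ! s"
  using sorted_wrt_nth_less[of "(<)" "T ! j" r s] by (auto simp: tableau_def)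

lemma tableau_row:
  "tableau T \<Longrightarrow> Suc j < length T \<Longrightarrow> r < length (T ! Suc j) \<Longrightarrow> \<not> T ! Suc j ! r < T ! j ! r"
  by (simp add: tableau_def)

text \<open>Induction along the diagonal: \<open>T ! j ! r\<close>, the entry reached so far and the
  entry beneath it form a chain, and freeness carries the bound to the right neighbour of the lowest
  one.\<close>

lemma tableau_below_diagonal_less:
  fixes T :: "'a::order list list"
  assumes "three_plus_one_free TYPE('a)" "tableau T"
  shows "j + t < length T \<Longrightarrow> Suc r + t < length (T ! (j + t)) \<Longrightarrow> T ! j ! r < T ! (j + t) ! (Suc r + t)"
proof (induction t)
  case 0
  then show ?case using tableau_column_less[OF assms(2)] by simp
next
  case (Suc t)
  have len: "length (T ! Suc (j + t)) \<le> length (T ! (j + t))"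
    using Suc.prems by (intro tableau_length_mono[OF assms(2)]) auto
  show ?case
  proof (rule three_chain_comparable[OF assms(1)])
    show "T ! j ! r < T ! (j + t) ! (Suc r + t)" using Suc len by simp
    show "T ! (j + t) ! (Suc r + t) < T ! (j + t) ! (Suc r + Suc t)"
      using Suc.prems len by (intro tableau_column_less[OF assms(2)]) auto
    show "\<not> T ! (j + Suc t) ! (Suc r + Suc t) < T ! (j + t) ! (Suc r + Suc t)"
      using tableau_row[OF assms(2), of "j + t" "Suc r + Suc t"] Suc.prems by simp
  qed
qed

text \<open>Otherwise \<open>tableau_below_diagonal_less\<close> would put the later entry below its
  own left neighbour.\<close>

lemma tableau_diagonal_not_less:
  fixes T :: "'a::order list list"
  assumes "three_plus_one_free TYPE('a)" "tableau T" "j + Suc t < length T" "r + Suc t < length (T ! (j + Suc t))"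
  shows "\<not> T ! (j + Suc t) ! (r + Suc t) < T ! j ! r"
proof
  assume "T ! (j + Suc t) ! (r + Suc t) < T ! j ! r"
  also have "T ! j ! r < T ! (j + t) ! (Suc r + t)"
    using assms(3,4) tableau_length_mono[OF assms(2), of "j + t" "j + Suc t"]
    by (intro tableau_below_diagonal_less assms(1,2)) auto
  finally show False
    using tableau_row[OF assms(2), of "j + t" "r + Suc t"] assms(3,4) by simp
qed

section \<open>From column words to diagonal words\<close>

context plac_algebra
begin

text \<open>The letters of \<open>v\<close> pass the chain one at a time; each one, once moved,
  plays the role of \<open>b\<close> for the next.\<close>

lemma uw_slide_word:
  assumes "sorted_wrt (>) w" "\<And>z. z \<in> set w \<Longrightarrow> z < b \<and> (\<forall>x\<in>set v. z < x)"
    and "sorted_wrt (\<lambda>x y. \<not> y < x) (b # v)"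
  shows "u b * uw w * uw v = u b * uw v * uw w"
  using assms
proof (induction v arbitrary: b)
  case (Cons x v)
  have "u b * uw w * u x = u b * u x * uw w"
    using Cons.prems by (intro uw_slide) auto
  moreover have "u x * uw w * uw v = u x * uw v * uw w"
    using Cons.prems by (intro Cons.IH) auto
  ultimately show ?case by (simp flip: mult.assoc) (simp add: mult.assoc)
qed simp

text \<open>Induction on \<open>k\<close>: the rest of the diagonal starting at \<open>C ! k\<close>
  slides left past the part of the column above this box, and the shorter column is treated by the
  induction hypothesis.\<close>

lemma uw_column_diagonals:
  assumes T: "tableau (C # T)" and "k \<le> length C"
  shows "uw (rev (take k C) @ concat (map (\<lambda>n. diagonal N T (- int n)) (rev [1..<Suc k])))
      = uw (concat (map (\<lambda>n. C ! (n - 1) # diagonal N T (- int n)) (rev [1..<Suc k])))"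
  using assms(2)
proof (induction k)
  case (Suc k)
  define v where "v = diagonal N T (- int (Suc k))"
  have C: "sorted_wrt (<) C" using T by (simp add: tableau_def)
  \<comment> \<open>In \<open>C # T\<close> the letters of \<open>v\<close> lie on the diagonal that
    starts at \<open>C ! k\<close>.\<close>
  have v: "\<exists>t. x = (C # T) ! Suc t ! (k + Suc t) \<and> Suc t < length (C # T) \<and> k + Suc t < length ((C # T) ! Suc t)"
    if x: "x \<in> set v" for x
  proof -
    obtain r where r: "x = T ! nat (int r + - int (Suc k)) ! r" "0 \<le> int r + - int (Suc k)"
      "nat (int r + - int (Suc k)) < length T" "r < length (T ! nat (int r + - int (Suc k)))"
      using x unfolding v_def diagonal_def by auto
    then have "r = k + Suc (nat (int r + - int (Suc k)))" by linarith
    then show ?thesis using r by (intro exI[of _ "nat (int r + - int (Suc k))"]) auto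
  qed
  have "u (C ! k) * uw (rev (take k C)) * uw v = u (C ! k) * uw v * uw (rev (take k C))"
  proof (rule uw_slide_word)
    show "sorted_wrt (>) (rev (take k C))"
      using C by (simp add: sorted_wrt_rev sorted_wrt_take)
    show "z < C ! k \<and> (\<forall>x\<in>set v. z < x)" if z: "z \<in> set (rev (take k C))" for z
    proof -
      obtain i where i: "i < k" "z = C ! i" using z Suc.prems by (auto simp: in_set_conv_nth)
      have "z < x" if x: "x \<in> set v" for x
      proof -
        obtain t where t: "x = (C # T) ! Suc t ! (k + Suc t)" "Suc t < length (C # T)"
          "k + Suc t < length ((C # T) ! Suc t)" using v[OF x] by metis
        \<comment> \<open>First compare with the box just below the diagonal through
          \<open>C ! i\<close>, then go down its column to row \<open>k + Suc t\<close>.\<close>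
        have "C ! i < (C # T) ! Suc t ! (Suc i + Suc t)"
          using tableau_below_diagonal_less[OF free31 T, of 0 "Suc t" i] t(2,3) i(1) by simp
        also have "\<dots> \<le> (C # T) ! Suc t ! (k + Suc t)"
        proof (cases "Suc i = k")
          case False
          then show ?thesis
            using tableau_column_less[OF T t(2), of "Suc i + Suc t" "k + Suc t"] t(3) i(1)
            by (simp add: order.strict_implies_order)
        qed simp
        finally show ?thesis using i t(1) by simp
      qed
      moreover have "z < C ! k"
        using i Suc.prems sorted_wrt_nth_less[OF C, of i k] by simp
      ultimately show ?thesis by simp
    qed
    have "\<not> x < C ! k" if "x \<in> set v" for x
      using v[OF that] tableau_diagonal_not_less[OF free31 T, of 0 _ k] by auto
    moreover have "sorted_wrt (\<lambda>x y. \<not> y < x) v"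
      unfolding v_def diagonal_def sorted_wrt_map
    proof (rule sorted_wrt_mono_rel[OF _ sorted_wrt_filter[OF sorted_wrt_upt]])
      fix r s
      assume r: "r \<in> set (filter (\<lambda>r. 0 \<le> int r + - int (Suc k) \<and> nat (int r + - int (Suc k)) < length T
          \<and> r < length (T ! nat (int r + - int (Suc k)))) [0..<N])"
        and s: "s \<in> set (filter (\<lambda>r. 0 \<le> int r + - int (Suc k) \<and> nat (int r + - int (Suc k)) < length T
          \<and> r < length (T ! nat (int r + - int (Suc k)))) [0..<N])" and "r < s"
      define j t where "j = nat (int r + - int (Suc k))" and "t = s - Suc r"
      have st: "s = r + Suc t" "nat (int s + - int (Suc k)) = j + Suc t"
        using r \<open>r < s\<close> by (auto simp: j_def t_def)
      have "j + Suc t < length T" "s < length (T ! (j + Suc t))"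
        using s unfolding set_filter mem_Collect_eq st(2) by blast+
      then show "\<not> T ! nat (int s + - int (Suc k)) ! s < T ! nat (int r + - int (Suc k)) ! r"
        using tableau_diagonal_not_less[OF free31 T, of "Suc j" t r]
        unfolding st(2) j_def[symmetric] by (simp add: st(1))
    qed
    ultimately show "sorted_wrt (\<lambda>x y. \<not> y < x) (C ! k # v)" by simp
  qed
  note slide = this
  define A where "A = concat (map (\<lambda>n. diagonal N T (- int n)) (rev [1..<Suc k]))"
  define B where "B = concat (map (\<lambda>n. C ! (n - 1) # diagonal N T (- int n)) (rev [1..<Suc k]))"
  have IH: "uw (rev (take k C)) * uw A = uw B"
    using Suc by (simp add: A_def B_def del: upt_Suc)
  have "rev [1..<Suc (Suc k)] = Suc k # rev [1..<Suc k]" by simp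
  moreover have "rev (take (Suc k) C) = C ! k # rev (take k C)"
    using Suc.prems by (simp add: take_Suc_conv_app_nth)
  moreover have "uw ((C ! k # rev (take k C)) @ v @ A) = uw ((C ! k # v) @ B)"
    using arg_cong[OF slide, of "\<lambda>x. x * uw A"] by (simp add: IH[symmetric] mult.assoc)
  ultimately show ?case
    by (simp add: A_def B_def v_def del: upt_Suc of_nat_Suc)
qed simp

text \<open>Induction on the columns: the tail is already read by diagonals, and the first column is
  threaded through the negative ones.\<close>

lemma uw_columns_eq_diagonals:
  assumes "tableau T" "\<forall>w\<in>set T. length w \<le> N \<and> length w \<le> M" "length T \<le> M'"
  shows "uw (concat (map rev T)) = uw (concat (map (diagonal N T) [- int M..int M']))"
  using assms
proof (induction T arbitrary: M')
  case Nil
  have "diagonal N ([] :: 'a list list) = (\<lambda>_. [])" by (simp add: diagonal_def fun_eq_iff)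
  then show ?case by (simp add: map_replicate_const)
next
  case (Cons C T)
  obtain m where m: "M' = Suc m" using Cons.prems(3) by (cases M') auto
  have T: "tableau T" using Cons.prems(1) by (force simp: tableau_def)
  have len: "\<forall>w\<in>set T. length w \<le> length C" using Cons.prems(1) by (simp add: tableau_def)
  have "uw (concat (map rev T)) = uw (concat (map (diagonal N T) [- int M..int m]))"
    using Cons.prems m by (intro Cons.IH T) auto
  moreover have "length C \<le> N" "length C \<le> M" using Cons.prems(2) by auto
  note diags = concat_diagonal_Cons[OF this len, of m]
  ultimately show ?case
    using uw_column_diagonals[OF Cons.prems(1), of "length C" N]
    by (simp add: diags m mult.assoc[symmetric] del: upt_Suc of_nat_Suc)
qed

end

lemma (in flagged_shape) ndet_eq_diagonal_words:
  "ndet l (\<lambda>j p. e (int (\<alpha> ! j) + int p - int j) (Z ! j)) = (\<Sum>T\<in>SSYT_Z \<alpha> Z. uw (diagword \<alpha> T))"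
proof -
  have "uw (concat (map rev T)) = uw (diagword \<alpha> T)" if "T \<in> SSYT_Z \<alpha> Z" for T
  proof -
    have F: "T \<in> fills (\<lambda>_. 0)" using that by (simp add: SSYT_eq_fills)
    have \<alpha>: "\<alpha> = map length T"
      using F by (intro nth_equalityI) (auto simp: fills_def)
    have len: "length T = l" "\<And>j. j < l \<Longrightarrow> length (T ! j) = \<alpha> ! j"
      using F by (auto simp: fills_def)
    have "tableau T"
      unfolding tableau_def
    proof (intro conjI allI impI ballI)
      show "sorted_wrt (\<ge>) (map length T)" using part \<alpha> by metis
      show "sorted_wrt (<) w" if "w \<in> set T" for w
        using that F by (auto simp: fills_def in_set_conv_nth)
      show "\<not> T ! Suc j ! r < T ! j ! r" if "Suc j < length T" "r < length (T ! Suc j)" for j r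
        using that fills_row[OF F, of j r] len \<alpha>_mono[of j] by simp
    qed
    moreover have "length w \<le> sum_list \<alpha>" if "w \<in> set T" for w
      using that unfolding \<alpha> by (intro member_le_sum_list) auto
    ultimately show ?thesis
      using uw_columns_eq_diagonals[of T "sum_list \<alpha>" "sum_list \<alpha>" l]
        diagword_eq_concat_diagonal[of T, folded \<alpha>] len(1) by simp
  qed
  then show ?thesis unfolding ndet_eq_column_words by (intro sum.cong refl)
qed

section \<open>The quotient ring\<close>

lemma nc_add_assoc: "nc_add (nc_add f g) h = nc_add f (nc_add g h)"
  and nc_add_commute: "nc_add f g = nc_add g f"
  and nc_zero_add: "nc_add nc_zero f = f"
  and nc_neg_add: "nc_add (nc_neg f) f = nc_zero"
  by (simp_all add: nc_add_def nc_zero_def nc_neg_def fun_eq_iff)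

lemma nc_mult_assoc: "nc_mult (nc_mult f g) h = nc_mult f (nc_mult g h)"
proof
  fix w :: "'a list"
  define n where "n = length w"
  have inner: "nc_mult f g (take i w) = (\<Sum>j\<le>i. f (take j w) * g (take (i - j) (drop j w)))"
    if "i \<le> n" for i
    using that by (simp add: nc_mult_def n_def min_def drop_take cong: sum.cong_simp)
  have "nc_mult (nc_mult f g) h w
    = (\<Sum>(i, j)\<in>(SIGMA i:{..n}. {..i}). f (take j w) * g (take (i - j) (drop j w)) * h (drop i w))"
    unfolding nc_mult_def[of "nc_mult f g"] n_def[symmetric]
    by (simp add: inner sum.Sigma[symmetric] sum_distrib_right cong: sum.cong_simp)
  also have "\<dots> = (\<Sum>(j, k)\<in>(SIGMA j:{..n}. {..n - j}). f (take j w) * (g (take k (drop j w)) * h (drop k (drop j w))))"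
    by (rule sum.reindex_bij_witness[of _ "\<lambda>(j, k). (j + k, j)" "\<lambda>(i, j). (j, i - j)"])
      (auto simp: mult.assoc)
  also have "\<dots> = nc_mult f (nc_mult g h) w"
    by (simp add: nc_mult_def n_def sum.Sigma[symmetric] sum_distrib_left)
  finally show "nc_mult (nc_mult f g) h w = nc_mult f (nc_mult g h) w" .
qed

lemma nc_mult_monom_left:
  "nc_mult (nc_monom v) f = (\<lambda>w. if take (length v) w = v then f (drop (length v) w) else 0)"
proof
  fix w :: "'a list"
  have "nc_mult (nc_monom v) f w = (\<Sum>i\<le>length w. if take i w = v then f (drop i w) else 0)"
    unfolding nc_mult_def nc_monom_def by (intro sum.cong) auto
  also have "\<dots> = (\<Sum>i\<in>{..length w} \<inter> {length v}. if take i w = v then f (drop i w) else 0)"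
    by (rule sum.mono_neutral_right) auto
  also have "\<dots> = (if take (length v) w = v then f (drop (length v) w) else 0)"
    by (cases "length v \<le> length w") auto
  finally show "nc_mult (nc_monom v) f w = (if take (length v) w = v then f (drop (length v) w) else 0)" .
qed

lemma nc_monom_append: "nc_monom (v @ w) = nc_mult (nc_monom v) (nc_monom w)"
proof -
  have "x = v @ w \<longleftrightarrow> take (length v) x = v \<and> drop (length v) x = w" for x
    by (metis append_eq_conv_conj append_take_drop_id)
  then show ?thesis unfolding nc_mult_monom_left by (auto simp: nc_monom_def fun_eq_iff)
qed

lemma nc_one_mult: "nc_mult nc_one f = f"
  by (simp add: nc_one_def nc_mult_monom_left)

lemma nc_mult_one: "nc_mult f nc_one = f"
proof
  fix w :: "'a list"
  have "nc_mult f nc_one w = (\<Sum>i\<le>length w. if i = length w then f w else 0)"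
    unfolding nc_mult_def nc_one_def nc_monom_def by (intro sum.cong) auto
  then show "nc_mult f nc_one w = f w" by simp
qed

lemma nc_mult_add_left: "nc_mult (nc_add f g) h = nc_add (nc_mult f h) (nc_mult g h)"
  and nc_mult_add_right: "nc_mult h (nc_add f g) = nc_add (nc_mult h f) (nc_mult h g)"
  by (simp_all add: nc_mult_def nc_add_def algebra_simps sum.distrib)

text \<open>Coefficient functions also include infinite formal sums; the free ring consists of the
  finitely supported ones.\<close>

definition finsupp :: "'a ncpoly \<Rightarrow> bool" where
  "finsupp f \<longleftrightarrow> finite {w. f w \<noteq> 0}"

lemma finsupp_basic:
  "finsupp nc_zero" "finsupp (nc_monom w)" "finsupp nc_one"
  "finsupp f \<Longrightarrow> finsupp g \<Longrightarrow> finsupp (nc_add f g)"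
  "finsupp f \<Longrightarrow> finsupp g \<Longrightarrow> finsupp (nc_diff f g)"
  "finsupp f \<Longrightarrow> finsupp (nc_neg f)"
  "finsupp f \<Longrightarrow> finsupp (nc_smult c f)"
  by (auto simp: finsupp_def nc_zero_def nc_one_def nc_monom_def nc_add_def nc_diff_def nc_neg_def nc_smult_def
      elim: rev_finite_subset intro: finite_subset[of _ "{w. f w \<noteq> 0} \<union> {w. g w \<noteq> 0}"])

lemma finsupp_mult:
  assumes "finsupp f" "finsupp g"
  shows "finsupp (nc_mult f g)"
proof -
  have "w \<in> (\<lambda>(x, y). x @ y) ` ({w. f w \<noteq> 0} \<times> {w. g w \<noteq> 0})" if "nc_mult f g w \<noteq> 0" for w
  proof -
    obtain i where "f (take i w) * g (drop i w) \<noteq> 0"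
      using \<open>nc_mult f g w \<noteq> 0\<close> unfolding nc_mult_def by (meson sum.not_neutral_contains_not_neutral)
    then show ?thesis by (intro image_eqI[of _ _ "(take i w, drop i w)"]) auto
  qed
  then have "{w. nc_mult f g w \<noteq> 0} \<subseteq> (\<lambda>(x, y). x @ y) ` ({w. f w \<noteq> 0} \<times> {w. g w \<noteq> 0})" by blast
  then show ?thesis unfolding finsupp_def
    by (rule finite_subset) (use assms in \<open>simp add: finsupp_def\<close>)
qed

lemma finsupp_sum: "(\<And>x. x \<in> A \<Longrightarrow> finsupp (F x)) \<Longrightarrow> finite A \<Longrightarrow> finsupp (nc_sum F A)"
proof -
  assume F: "\<And>x. x \<in> A \<Longrightarrow> finsupp (F x)" and A: "finite A"
  have "{w. nc_sum F A w \<noteq> 0} \<subseteq> (\<Union>x\<in>A. {w. F x w \<noteq> 0})"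
    by (auto simp: nc_sum_def elim: sum.not_neutral_contains_not_neutral)
  then show ?thesis unfolding finsupp_def
    by (rule finite_subset) (use F A in \<open>simp add: finsupp_def\<close>)
qed

lemma finsupp_prod_list: "(\<And>x. x \<in> set xs \<Longrightarrow> finsupp (F x)) \<Longrightarrow> finsupp (nc_prod_list F xs)"
  by (induction xs) (auto simp: nc_prod_list_def finsupp_basic finsupp_mult)

section \<open>Closure properties of the plactic ideal\<close>

lemma I_plac_smult: "x \<in> I_plac \<Longrightarrow> nc_smult c x \<in> I_plac"
proof -
  assume x: "x \<in> I_plac"
  have nat: "nc_smult (int n) x \<in> I_plac" for n
  proof (induction n)
    case 0
    have "nc_smult (int 0) x = nc_zero" by (simp add: nc_smult_def nc_zero_def)
    then show ?case using I_plac.zero by simp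
  next
    case (Suc n)
    have "nc_smult (int (Suc n)) x = nc_add x (nc_smult (int n) x)"
      by (simp add: nc_smult_def nc_add_def algebra_simps)
    then show ?case using Suc x I_plac.add by metis
  qed
  show ?thesis
  proof (cases c)
    case (nonneg n)
    then show ?thesis using nat by simp
  next
    case (neg n)
    have "nc_smult (- int (Suc n)) x = nc_neg (nc_smult (int (Suc n)) x)"
      by (simp add: nc_smult_def nc_neg_def fun_eq_iff del: of_nat_Suc)
    then show ?thesis using nat I_plac.neg \<open>c = - int (Suc n)\<close> by metis
  qed
qed

lemma I_plac_sum: "(\<And>x. x \<in> A \<Longrightarrow> F x \<in> I_plac) \<Longrightarrow> finite A \<Longrightarrow> nc_sum F A \<in> I_plac"
proof (induction A rule: infinite_finite_induct)
  case empty
  then show ?case using I_plac.zero by (simp add: nc_sum_def nc_zero_def)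
next
  case (insert x A)
  then have "nc_sum F (insert x A) = nc_add (F x) (nc_sum F A)"
    by (simp add: nc_sum_def nc_add_def)
  moreover have "F x \<in> I_plac" "nc_sum F A \<in> I_plac" using insert by auto
  ultimately show ?case using I_plac.add by metis
qed simp

lemma I_plac_monom:
  assumes "x \<in> I_plac"
  shows "nc_mult (nc_monom w) x \<in> I_plac" "nc_mult x (nc_monom w) \<in> I_plac"
proof -
  show "nc_mult (nc_monom w) x \<in> I_plac"
  proof (induction w)
    case Nil
    then show ?case using assms by (simp add: nc_one_mult flip: nc_one_def)
  next
    case (Cons a w)
    then show ?case
      using I_plac.lmult[of _ a] nc_monom_append[of "[a]" w] by (simp add: nc_mult_assoc)
  qed
  show "nc_mult x (nc_monom w) \<in> I_plac"
  proof (induction w rule: rev_induct)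
    case Nil
    then show ?case using assms by (simp add: nc_mult_one flip: nc_one_def)
  next
    case (snoc a w)
    then show ?case
      using I_plac.rmult[of _ a] nc_monom_append[of w "[a]"] by (simp flip: nc_mult_assoc)
  qed
qed

lemma finsupp_expand: "finsupp f \<Longrightarrow> f = nc_sum (\<lambda>w. nc_smult (f w) (nc_monom w)) {w. f w \<noteq> 0}"
  by (auto simp: finsupp_def nc_sum_def nc_smult_def nc_monom_def fun_eq_iff if_distrib[of "(*) _"] cong: if_cong)

text \<open>The rules of \<open>I_plac\<close> multiply only by single letters; expanding
  \<open>f\<close> into finitely many monomials reduces to them.\<close>

lemma I_plac_mult:
  assumes "x \<in> I_plac" "finsupp f"
  shows "nc_mult f x \<in> I_plac" "nc_mult x f \<in> I_plac"
proof -
  let ?A = "{w. f w \<noteq> 0}"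
  have "nc_mult f x = nc_sum (\<lambda>w. nc_smult (f w) (nc_mult (nc_monom w) x)) ?A"
    by (subst finsupp_expand[OF assms(2)], unfold nc_mult_def nc_sum_def nc_smult_def)
      (simp add: sum_distrib_left sum_distrib_right mult.assoc sum.swap[of _ ?A])
  then show "nc_mult f x \<in> I_plac"
    using assms by (auto simp: finsupp_def intro: I_plac_sum I_plac_smult I_plac_monom)
  have "nc_mult x f = nc_sum (\<lambda>w. nc_smult (f w) (nc_mult x (nc_monom w))) ?A"
    by (subst finsupp_expand[OF assms(2)], unfold nc_mult_def nc_sum_def nc_smult_def)
      (simp add: sum_distrib_left sum_distrib_right mult.left_commute sum.swap[of _ ?A])
  then show "nc_mult x f \<in> I_plac"
    using assms by (auto simp: finsupp_def intro: I_plac_sum I_plac_smult I_plac_monom)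
qed

text \<open>The generators are differences of words of length three, so no constant term can arise;
  this gives \<open>0 \<noteq> 1\<close> in the quotient.\<close>

lemma I_plac_Nil: "x \<in> I_plac \<Longrightarrow> x [] = 0"
  by (induction rule: I_plac.induct)
    (auto simp: nc_zero_def nc_add_def nc_neg_def nc_mult_def nc_diff_def nc_monom_def elim!: plac_gen.cases)

definition plac_rel :: "'a::order ncpoly \<Rightarrow> 'a ncpoly \<Rightarrow> bool" where
  "plac_rel f g \<longleftrightarrow> finsupp f \<and> finsupp g \<and> plac_cong f g"

lemma plac_cong_refl: "plac_cong f f"
proof -
  have "nc_diff f f = nc_zero" by (simp add: nc_diff_def nc_zero_def)
  then show ?thesis by (simp add: plac_cong_def I_plac.zero)
qed

lemma plac_rel_refl: "finsupp f \<Longrightarrow> plac_rel f f"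
  by (simp add: plac_rel_def plac_cong_refl)

lemma symp_plac_rel: "symp plac_rel"
proof (rule sympI)
  fix f g :: "'a ncpoly"
  assume "plac_rel f g"
  moreover have "nc_diff g f = nc_neg (nc_diff f g)" by (simp add: nc_diff_def nc_neg_def)
  ultimately show "plac_rel g f" by (simp add: plac_rel_def plac_cong_def I_plac.neg)
qed

lemma transp_plac_rel: "transp plac_rel"
proof (rule transpI)
  fix f g h :: "'a ncpoly"
  assume "plac_rel f g" "plac_rel g h"
  moreover have "nc_diff f h = nc_add (nc_diff f g) (nc_diff g h)"
    by (simp add: nc_diff_def nc_add_def)
  ultimately show "plac_rel f h" by (simp add: plac_rel_def plac_cong_def I_plac.add)
qed

text \<open>Partial, because \<open>I_plac\<close> absorbs only finitely supported coefficient functions.\<close>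

quotient_type (overloaded) 'a plac = "'a::order ncpoly" / partial: plac_rel
  using plac_rel_refl[OF finsupp_basic(1)] symp_plac_rel transp_plac_rel by (blast intro: part_equivpI)

instantiation plac :: (order) ring_1
begin

lift_definition zero_plac :: "'a plac" is nc_zero
  by (simp add: plac_rel_refl finsupp_basic)

lift_definition one_plac :: "'a plac" is nc_one
  by (simp add: plac_rel_refl finsupp_basic)

lift_definition plus_plac :: "'a plac \<Rightarrow> 'a plac \<Rightarrow> 'a plac" is nc_add
proof -
  fix f f' g g' :: "'a ncpoly"
  assume "plac_rel f f'" "plac_rel g g'"
  moreover have "nc_diff (nc_add f g) (nc_add f' g') = nc_add (nc_diff f f') (nc_diff g g')"
    by (simp add: nc_diff_def nc_add_def fun_eq_iff)
  ultimately show "plac_rel (nc_add f g) (nc_add f' g')"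
    by (simp add: plac_rel_def plac_cong_def finsupp_basic I_plac.add)
qed

lift_definition uminus_plac :: "'a plac \<Rightarrow> 'a plac" is nc_neg
proof -
  fix f f' :: "'a ncpoly"
  assume "plac_rel f f'"
  moreover have "nc_diff (nc_neg f) (nc_neg f') = nc_neg (nc_diff f f')"
    by (simp add: nc_diff_def nc_neg_def)
  ultimately show "plac_rel (nc_neg f) (nc_neg f')"
    by (simp add: plac_rel_def plac_cong_def finsupp_basic I_plac.neg)
qed

definition minus_plac :: "'a plac \<Rightarrow> 'a plac \<Rightarrow> 'a plac" where
  "minus_plac x y = x + (- y)"

lift_definition times_plac :: "'a plac \<Rightarrow> 'a plac \<Rightarrow> 'a plac" is nc_mult
proof -
  fix f f' g g' :: "'a ncpoly"
  assume R: "plac_rel f f'" "plac_rel g g'"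
  have "nc_diff (nc_mult f g) (nc_mult f' g') = nc_add (nc_mult f (nc_diff g g')) (nc_mult (nc_diff f f') g')"
    by (simp add: nc_diff_def nc_add_def nc_mult_def fun_eq_iff algebra_simps sum.distrib sum_subtractf)
  then show "plac_rel (nc_mult f g) (nc_mult f' g')"
    using R by (simp add: plac_rel_def plac_cong_def finsupp_mult I_plac.add I_plac_mult)
qed

instance
proof
  fix x y z :: "'a plac"
  note laws = plac_rel_def plac_cong_refl finsupp_basic finsupp_mult
  show "x + y + z = x + (y + z)" by transfer (simp add: laws nc_add_assoc)
  show "x + y = y + x" by transfer (simp add: laws nc_add_commute)
  show "0 + x = x" by transfer (simp add: laws nc_zero_add)
  show "- x + x = 0" by transfer (simp add: laws nc_neg_add)
  show "x - y = x + - y" by (simp add: minus_plac_def)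
  show "x * y * z = x * (y * z)" by transfer (simp add: laws nc_mult_assoc)
  show "1 * x = x" by transfer (simp add: laws nc_one_mult)
  show "x * 1 = x" by transfer (simp add: laws nc_mult_one)
  show "(x + y) * z = x * z + y * z" by transfer (simp add: laws nc_mult_add_left)
  show "z * (x + y) = z * x + z * y" by transfer (simp add: laws nc_mult_add_right)
  show "(0 :: 'a plac) \<noteq> 1"
    by transfer (auto simp: plac_rel_def plac_cong_def nc_diff_def nc_zero_def nc_one_def nc_monom_def dest: I_plac_Nil)
qed

end

section \<open>The class map to the quotient ring and the transfer of the identity\<close>

definition cls :: "'a::order ncpoly \<Rightarrow> 'a plac" where "cls f = abs_plac f"

lemma cls_eq_iff: "finsupp f \<Longrightarrow> finsupp g \<Longrightarrow> cls f = cls g \<longleftrightarrow> plac_cong f g"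
  using Quotient_rel[OF Quotient_plac, of f g] plac_rel_refl[of f] plac_rel_refl[of g]
  by (simp add: cls_def plac_rel_def)

lemma cls_simps:
  "cls nc_zero = 0" "cls nc_one = 1"
  "finsupp f \<Longrightarrow> finsupp g \<Longrightarrow> cls (nc_add f g) = cls f + cls g"
  "finsupp f \<Longrightarrow> cls (nc_neg f) = - cls f"
  "finsupp f \<Longrightarrow> finsupp g \<Longrightarrow> cls (nc_mult f g) = cls f * cls g"
  by (simp_all add: cls_def zero_plac.abs_eq one_plac.abs_eq plus_plac.abs_eq uminus_plac.abs_eq
      times_plac.abs_eq plac_rel_refl)

lemma cls_sum:
  "(\<And>x. x \<in> A \<Longrightarrow> finsupp (F x)) \<Longrightarrow> finite A \<Longrightarrow> cls (nc_sum F A) = (\<Sum>x\<in>A. cls (F x))"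
proof (induction A rule: infinite_finite_induct)
  case empty
  have "nc_sum F {} = nc_zero" by (simp add: nc_sum_def nc_zero_def)
  then show ?case by (simp add: cls_simps)
next
  case (insert x A)
  then have "nc_sum F (insert x A) = nc_add (F x) (nc_sum F A)"
    by (simp add: nc_sum_def nc_add_def)
  then show ?case using insert by (simp add: cls_simps finsupp_sum)
qed simp

lemma cls_prod_list:
  "(\<And>x. x \<in> set xs \<Longrightarrow> finsupp (F x)) \<Longrightarrow> cls (nc_prod_list F xs) = prod_list (map (\<lambda>x. cls (F x)) xs)"
proof (induction xs)
  case (Cons x xs)
  have "nc_prod_list F (x # xs) = nc_mult (F x) (nc_prod_list F xs)"
    by (simp add: nc_prod_list_def)
  then show ?case using Cons by (simp add: cls_simps finsupp_prod_list)
qed (simp add: nc_prod_list_def cls_simps)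

lemma cls_monom: "cls (nc_monom w) = prod_list (map (\<lambda>a. cls (nc_monom [a])) w)"
proof (induction w)
  case Nil
  show ?case by (simp add: cls_simps flip: nc_one_def)
next
  case (Cons a w)
  then show ?case
    using nc_monom_append[of "[a]" w] by (simp add: cls_simps finsupp_basic)
qed

lemma cls_smult_sign:
  assumes "finsupp f"
  shows "cls (nc_smult (sign \<pi>) f) = of_int (sign \<pi>) * cls f"
proof -
  have "nc_smult 1 f = f" "nc_smult (- 1) f = nc_neg f"
    by (simp_all add: nc_smult_def nc_neg_def)
  then show ?thesis
    using assms by (simp add: sign_def cls_simps)
qed

lemma cls_plac_gen:
  assumes "plac_gen (nc_diff (nc_monom v) (nc_monom w))"
  shows "cls (nc_monom v) = cls (nc_monom w)"
  using assms by (simp add: cls_eq_iff finsupp_basic plac_cong_def I_plac.gen)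

lemma finsupp_eP: "finsupp (eP k (S :: 'a::{finite,order} set))"
  unfolding eP_def by (auto intro: finsupp_basic finsupp_sum finite_dec_chains)

theorem mainTheorem16:
  fixes \<alpha> :: "nat list" and Z :: "('a::{finite,order}) set list"
  assumes "three_plus_one_free TYPE('a)"
    and "sorted_wrt (\<ge>) \<alpha>"
    and "length Z = length \<alpha>"
    and "\<forall>i<length Z. lower_order_ideal (Z ! i)"
    and "\<forall>i. Suc i < length Z \<longrightarrow> Z ! i \<subseteq> Z ! Suc i"
  shows "plac_cong (JP \<alpha> Z) (nc_sum (\<lambda>T. nc_monom (diagword \<alpha> T)) (SSYT_Z \<alpha> Z))"
proof -
  define u :: "'a \<Rightarrow> 'a plac" where "u = (\<lambda>a. cls (nc_monom [a]))"
  have u3: "u a * u b * u c = cls (nc_monom [a, b, c])" for a b c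
    by (simp add: cls_monom[of "[a, b, c]"] u_def mult.assoc)
  \<comment> \<open>Through \<open>u3\<close> the three relations become equalities of classes of
    words, instances of \<open>cls_plac_gen\<close>.\<close>
  interpret flagged_shape u \<alpha> Z
    using assms unfolding u3[symmetric]
    by unfold_locales (auto simp: u3 intro: cls_plac_gen plac_gen.intros)
  have uw: "cls (nc_monom w) = uw w" for w
    unfolding uw_def by (simp add: cls_monom[of w] u_def)
  have e: "cls (eP k S) = e k S" for k S
    by (simp add: eP_def e_def cls_simps cls_sum finsupp_basic finite_dec_chains uw)
  have fin_SSYT: "finite (SSYT_Z \<alpha> Z)"
    using finite_fills by (simp add: SSYT_eq_fills)
  have fin: "finsupp (nc_prod_list (\<lambda>i. eP (int (\<alpha> ! i) + int (\<pi> i) - int i) (Z ! i)) [0..<l])" for \<pi>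
    by (intro finsupp_prod_list finsupp_eP)
  have "cls (JP \<alpha> Z) = ndet l (\<lambda>j p. e (int (\<alpha> ! j) + int p - int j) (Z ! j))"
    by (simp add: JP_def ndet_def cls_sum fin finsupp_basic finite_permutations cls_smult_sign cls_prod_list
        finsupp_eP e)
  also have "\<dots> = cls (nc_sum (\<lambda>T. nc_monom (diagword \<alpha> T)) (SSYT_Z \<alpha> Z))"
    by (simp add: ndet_eq_diagonal_words cls_sum finsupp_basic fin_SSYT uw)
  \<comment> \<open>Equal classes mean congruence only between finitely supported elements, hence
    the support conditions.\<close>
  finally show ?thesis
    by (subst (asm) cls_eq_iff)
      (auto simp: JP_def intro!: finsupp_sum finsupp_basic fin fin_SSYT finite_permutations)
qed

end
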